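(* Let $\tilde\theta$ be a probability distribution on $\mathbb{R}^d$ satisfying: there is a convex open set $\Theta\subseteq\mathbb{R}^d$, with $d\ge 5$, such that $\tilde\theta$ has a probability density function $p$ that is continuously differentiable on $\Theta$, $\mathbb{P}_{\theta\sim\tilde\theta}[\theta\in\Theta]=1$, and $\mathbb{E}_{\theta\sim\tilde\theta}\|\theta\|_2<\infty$. Let $H_\infty=\nabla^2\mathcal{L}_\infty(g_\infty)$ be the Hessian matrix at the geometric median $g_\infty$ of $\tilde\theta$. Then the geometric median is asymptotically $\mathrm{Skew}(H_\infty)$-strategyproof: for all $\varepsilon,\delta>0$ there exists $V_0\ge 1$ such that for all $V\ge V_0$, if $\theta_1,\dots,\theta_V$ are drawn independently from $\tilde\theta$ and $\vec\theta=(\theta_1,\dots,\theta_V)$, then with probability at least $1-\delta$, $$\forall t,s\in\mathbb{R}^d,\quad \|\mathrm{Gm}(t,\vec\theta)-t\|_2\le\big(1+\mathrm{Skew}(H_\infty)+\varepsilon\big)\,\|\mathrm{Gm}(s,\vec\theta)-t\|_2 .$$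
   Context: For $s\in\mathbb{R}^d$ and $\vec\theta=(\theta_1,\dots,\theta_V)\in(\mathbb{R}^d)^V$, $\mathrm{Gm}(s,\vec\theta)$ denotes a minimizer over $z\in\mathbb{R}^d$ of $\frac{1}{1+V}\big(\|z-s\|_2+\sum_{v=1}^V\|z-\theta_v\|_2\big)$. $\mathcal{L}_\infty(z)=\mathbb{E}_{\theta\sim\tilde\theta}\|z-\theta\|_2$ and $g_\infty$ is the minimizer of $\mathcal{L}_\infty$ over $\mathbb{R}^d$. (Under the stated assumption on $\tilde\theta$, $\mathcal{L}_\infty$ is twice continuously differentiable with positive definite Hessian on $\Theta$, and $g_\infty$ exists, is unique and lies in $\Theta$, so that $H_\infty$ is well defined and positive definite.) For a (symmetric) positive definite matrix $S$, $\mathrm{Skew}(S)=\sup_{x\ne 0}\Big\{\frac{\|x\|_2\|Sx\|_2}{x^TSx}-1\Big\}$. *)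

theory Defs
  imports "HOL-Probability.Probability"
begin

definition gm_loss :: "nat \<Rightarrow> (nat \<Rightarrow> real ^ 'n) \<Rightarrow> real ^ 'n \<Rightarrow> real ^ 'n \<Rightarrow> real" where
  "gm_loss V \<theta> s z = 1 / (1 + real V) * (norm (z - s) + (\<Sum>v=1..V. norm (z - \<theta> v)))"

text \<open>
  The empirical geometric median is a relation rather than a function: minimizers need not be
  unique when all points are collinear, and a choice function would have no useful measurability.
\<close>

definition is_Gm :: "nat \<Rightarrow> (nat \<Rightarrow> real ^ 'n) \<Rightarrow> real ^ 'n \<Rightarrow> real ^ 'n \<Rightarrow> bool" where
  "is_Gm V \<theta> s z \<longleftrightarrow> is_arg_min (gm_loss V \<theta> s) (\<lambda>_. True) z"

lemma is_Gm_exists: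
  fixes s :: "real ^ 'n"
  shows "\<exists>z. is_Gm V \<theta> s z"
proof -
  let ?f = "gm_loss V \<theta> s"
  let ?r = "(1 + real V) * ?f s"
  have nonneg: "0 \<le> ?f z" for z
    unfolding gm_loss_def by (intro mult_nonneg_nonneg add_nonneg_nonneg sum_nonneg) auto
  have "continuous_on (cball s ?r) ?f"
    unfolding gm_loss_def by (intro continuous_intros)
  moreover have s_in: "s \<in> cball s ?r"
    using nonneg[of s] by simp
  ultimately obtain z where z: "\<And>y. y \<in> cball s ?r \<Longrightarrow> ?f z \<le> ?f y"
    using continuous_attains_inf[of "cball s ?r" ?f] by (auto simp del: mem_cball)
  have "?f z \<le> ?f y" for y
  proof (cases "y \<in> cball s ?r")
    case False
    have "norm (y - s) \<le> (1 + real V) * ?f y"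
      unfolding gm_loss_def by (simp add: sum_nonneg)
    moreover have "?r < norm (y - s)"
      using False by (simp add: dist_norm norm_minus_commute)
    ultimately have "?r < (1 + real V) * ?f y"
      by (rule less_le_trans[rotated])
    then have "?f s < ?f y"
      by (rule mult_left_less_imp_less) simp
    then show ?thesis using z[OF s_in] by simp
  qed (rule z)
  then show ?thesis
    unfolding is_Gm_def is_arg_min_def by (auto simp: not_less)
qed

definition L_inf :: "(real ^ 'n) measure \<Rightarrow> real ^ 'n \<Rightarrow> real" where
  "L_inf M z = (\<integral>\<theta>. norm (z - \<theta>) \<partial>M)"

definition g_inf :: "(real ^ 'n) measure \<Rightarrow> real ^ 'n" where
  "g_inf M = (THE g. is_arg_min (L_inf M) (\<lambda>_. True) g)"

definition gradient :: "(real ^ 'n \<Rightarrow> real) \<Rightarrow> real ^ 'n \<Rightarrow> real ^ 'n" where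
  "gradient f x = (THE D. GDERIV f x :> D)"

definition hessian :: "(real ^ 'n \<Rightarrow> real) \<Rightarrow> real ^ 'n \<Rightarrow> real ^ 'n ^ 'n" where
  "hessian f x = jacobian (gradient f) (at x)"

definition H_inf :: "(real ^ 'n) measure \<Rightarrow> real ^ 'n ^ 'n" where
  "H_inf M = hessian (L_inf M) (g_inf M)"

text \<open>
  For positive definite \<open>S\<close> the set of values is bounded, so the real-valued supremum is the
  intended one.
\<close>

definition Skew :: "real ^ 'n ^ 'n \<Rightarrow> real" where
  "Skew S = (SUP x\<in>{x. x \<noteq> 0}. norm x * norm (S *v x) / (x \<bullet> (S *v x)) - 1)"

definition cont_differentiable_on :: "(real ^ 'n \<Rightarrow> real) \<Rightarrow> (real ^ 'n) set \<Rightarrow> bool" where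
  "cont_differentiable_on f S \<longleftrightarrow> (\<exists>f'. (\<forall>x\<in>S. GDERIV f x :> f' x) \<and> continuous_on S f')"

end

theory Submission
  imports Defs
begin

text \<open>
  Let \<open>F(z) = \<Sum>v. norm (z - \<theta> v)\<close>, let \<open>g\<close> be the population median and \<open>H\<close> the Hessian of the
  population loss at \<open>g\<close>.  A continuous density gives \<open>E (1 / (norm (g - \<theta>))\<^sup>2) < \<infinity>\<close> in dimension at
  least 3, the only quantitative input.  With high probability no voter lies within
  distance \<open>O (V powr (-1/2))\<close> of \<open>g\<close>, the third-order terms of \<open>F\<close> on that ball are \<open>O (V)\<close>, the
  Hessian of \<open>F\<close> at \<open>g\<close> is \<open>V *\<^sub>R H\<close> up to a small relative error, and the gradient of \<open>F\<close> at \<open>g\<close> is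
  \<open>O (sqrt V)\<close>.  On such a sample every reachable median lies in the ball, and for two points of the
  ball the gradients of \<open>F\<close> differ by \<open>V *\<^sub>R H\<close> times their difference, up to a small relative error.
  The gradient is a unit vector \<open>u\<close> pointing to \<open>t\<close> at the truthful median \<open>x\<close> and has norm at most 1
  at any other reachable \<open>y\<close>, so \<open>u \<bullet> H (y - x)\<close> is almost nonpositive.  Projecting \<open>t - y\<close> onto
  \<open>H u\<close> bounds \<open>norm (x - t)\<close> by \<open>norm u * norm (H u) / (u \<bullet> H u)\<close> times \<open>norm (y - t)\<close>.
\<close>

subsection \<open>The direction field\<close>

text \<open>The derivative of \<open>sgn\<close> at \<open>a\<close>, hence the Hessian of the norm:
  projection off the line of \<open>a\<close>, divided by \<open>norm a\<close>. At
  \<open>a = 0\<close> it is zero, since the inverse of zero is zero.\<close>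

definition sgn_deriv :: "'a::real_inner \<Rightarrow> 'a \<Rightarrow> 'a" where
  "sgn_deriv a q = (q - (sgn a \<bullet> q) *\<^sub>R sgn a) /\<^sub>R norm a"

lemma inner_sgn_self: "sgn a \<bullet> a = norm (a::'a::real_inner)"
  by (cases "a = 0") (auto simp: sgn_div_norm power2_norm_eq_inner[symmetric] power2_eq_square)

lemma inner_sgn_le: "sgn a \<bullet> q \<le> norm (q::'a::real_inner)"
  using norm_cauchy_schwarz[of "sgn a" q] by (cases "a = 0") (auto simp: norm_sgn)

lemma abs_inner_sgn_le: "\<bar>sgn a \<bullet> q\<bar> \<le> norm (q::'a::real_inner)"
  using Cauchy_Schwarz_ineq2[of "sgn a" q] by (cases "a = 0") (auto simp: norm_sgn)

lemma norm_sgn_le_1: "norm (sgn (a::'a::real_normed_vector)) \<le> 1"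
  by (simp add: norm_sgn)

text \<open>\<open>sgn a\<close> is a subgradient of the norm even at the kink, where
  \<open>sgn 0 = 0\<close>, so sums over voters need no case distinction.\<close>

lemma norm_subgradient: "norm a + sgn a \<bullet> (b - a) \<le> norm (b::'a::real_inner)"
  using inner_sgn_le[of a b] by (simp add: inner_diff_right inner_sgn_self)

lemma norm_proj_square:
  fixes a q :: "'a::real_inner"
  assumes "a \<noteq> 0"
  shows "(norm (q - (sgn a \<bullet> q) *\<^sub>R sgn a))\<^sup>2 = (norm q)\<^sup>2 - (sgn a \<bullet> q)\<^sup>2"
proof -
  have "sgn a \<bullet> sgn a = 1"
    using assms by (simp add: power2_norm_eq_inner[symmetric] norm_sgn)
  then show ?thesis
    unfolding power2_norm_eq_inner
    by (simp add: inner_diff inner_commute[of q "sgn a"] power2_eq_square)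
qed

lemma norm_proj_le: "norm (q - (sgn a \<bullet> q) *\<^sub>R sgn a) \<le> norm (q::'a::real_inner)"
proof (cases "a = 0")
  case False
  then have "(norm (q - (sgn a \<bullet> q) *\<^sub>R sgn a))\<^sup>2 \<le> (norm q)\<^sup>2"
    by (simp add: norm_proj_square)
  then show ?thesis by (rule power2_le_imp_le) simp
qed simp

text \<open>The equality case of Cauchy-Schwarz. It confines a voter to a single line when a
  convexity estimate is tight.\<close>

lemma parallel_sgn:
  fixes a q :: "'a::real_inner"
  assumes "a \<noteq> 0" "(sgn a \<bullet> q)\<^sup>2 = (norm q)\<^sup>2"
  shows "q = (sgn a \<bullet> q) *\<^sub>R sgn a"
  using norm_proj_square[OF assms(1), of q] assms(2) by simp

lemma norm_sgn_deriv_le: "norm (sgn_deriv a q) \<le> norm q / norm (a::'a::real_inner)"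
  using norm_proj_le[of q a] by (simp add: sgn_deriv_def divide_inverse mult.commute[of "norm q"] mult_left_mono)

lemma has_derivative_sgn:
  fixes b :: "'a::real_inner"
  assumes "b \<noteq> 0"
  shows "(sgn has_derivative sgn_deriv b) (at b)"
proof -
  have "((\<lambda>z. inverse (norm z)) has_derivative (\<lambda>q. - (inverse (norm b) * (q \<bullet> sgn b) * inverse (norm b)))) (at b)"
    using assms by (intro Deriv.has_derivative_inverse has_derivative_norm) auto
  from has_derivative_scaleR[OF this has_derivative_ident]
  have "((\<lambda>z. inverse (norm z) *\<^sub>R z) has_derivative
      (\<lambda>q. inverse (norm b) *\<^sub>R q + (- (inverse (norm b) * (q \<bullet> sgn b) * inverse (norm b))) *\<^sub>R b)) (at b)" .
  also have "(\<lambda>q. inverse (norm b) *\<^sub>R q + (- (inverse (norm b) * (q \<bullet> sgn b) * inverse (norm b))) *\<^sub>R b) = sgn_deriv b"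
    unfolding sgn_deriv_def fun_eq_iff
    by (simp add: sgn_div_norm[of b] scaleR_diff_right inner_commute[of b])
  also have "(\<lambda>z. inverse (norm z) *\<^sub>R z) = (sgn :: 'a \<Rightarrow> 'a)"
    by (simp add: fun_eq_iff sgn_div_norm)
  finally show ?thesis .
qed

text \<open>Scaling by \<open>norm a\<close> splits the difference into a radial part and
  \<open>b - a\<close>, each of norm at most \<open>norm (b - a)\<close>.\<close>

lemma norm_sgn_diff_le:
  fixes a b :: "'a::real_inner"
  assumes "a \<noteq> 0"
  shows "norm (sgn b - sgn a) \<le> 2 * norm (b - a) / norm a"
proof (cases "b = 0")
  case True then show ?thesis using assms by (simp add: norm_sgn)
next
  case False
  have "norm a *\<^sub>R (sgn b - sgn a) = (norm a - norm b) *\<^sub>R sgn b + (b - a)"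
    using assms False by (simp add: sgn_div_norm algebra_simps)
  then have "norm a * norm (sgn b - sgn a) = norm ((norm a - norm b) *\<^sub>R sgn b + (b - a))"
    by (metis norm_scaleR abs_norm_cancel)
  also have "\<dots> \<le> \<bar>norm a - norm b\<bar> * norm (sgn b) + norm (b - a)"
    by (metis norm_scaleR norm_triangle_ineq)
  also have "\<dots> \<le> norm (b - a) + norm (b - a)"
    using norm_triangle_ineq3[of a b] False by (simp add: norm_sgn norm_minus_commute)
  finally show ?thesis using assms by (simp add: field_simps)
qed

text \<open>The change of the factor \<open>1 / norm\<close> contributes 2 to the constant and the
  change of the projection contributes 4. Closeness keeps \<open>norm b\<close> at least
  \<open>norm a / 2\<close>.\<close>

lemma norm_sgn_deriv_diff_le:
  fixes a b :: "'a::real_inner"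
  assumes a: "a \<noteq> 0" and ba: "norm (b - a) \<le> norm a / 2"
  shows "norm (sgn_deriv b q - sgn_deriv a q) \<le> 6 * norm (b - a) * norm q / (norm a)\<^sup>2"
proof -
  let ?P = "\<lambda>c. q - (sgn c \<bullet> q) *\<^sub>R sgn c"
  have na: "norm a > 0" using a by simp
  have nb: "norm b \<ge> norm a / 2"
    using ba norm_triangle_ineq3[of b a] by linarith
  then have nb0: "norm b > 0" using na by linarith
  have "norm ((1 / norm b - 1 / norm a) *\<^sub>R ?P b) \<le> \<bar>1 / norm b - 1 / norm a\<bar> * norm q"
    using norm_proj_le[of q b] by (simp add: mult_left_mono)
  also have "\<bar>1 / norm b - 1 / norm a\<bar> = \<bar>norm a - norm b\<bar> / (norm a * norm b)"
  proof -
    have "1 / norm b - 1 / norm a = (norm a - norm b) / (norm a * norm b)"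
      using na nb0 by (simp add: field_simps)
    then show ?thesis using na nb0 by (simp add: abs_mult)
  qed
  also have "\<dots> \<le> norm (b - a) / (norm a * (norm a / 2))"
    using norm_triangle_ineq3[of a b] na nb
    by (intro frac_le mult_left_mono mult_pos_pos) (auto simp: norm_minus_commute)
  finally have 1: "norm ((1 / norm b - 1 / norm a) *\<^sub>R ?P b) \<le> 2 * norm (b - a) * norm q / (norm a)\<^sup>2"
    by (simp add: power2_eq_square mult_right_mono field_simps)
  have "(sgn a \<bullet> q) *\<^sub>R sgn a - (sgn b \<bullet> q) *\<^sub>R sgn b
      = (sgn a \<bullet> q) *\<^sub>R (sgn a - sgn b) + ((sgn a - sgn b) \<bullet> q) *\<^sub>R sgn b"
    by (simp add: algebra_simps inner_diff_left)
  then have "norm ((sgn a \<bullet> q) *\<^sub>R sgn a - (sgn b \<bullet> q) *\<^sub>R sgn b)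
      \<le> \<bar>sgn a \<bullet> q\<bar> * norm (sgn a - sgn b) + \<bar>(sgn a - sgn b) \<bullet> q\<bar> * norm (sgn b)"
    by (metis norm_scaleR norm_triangle_ineq)
  also have "\<dots> \<le> norm q * norm (sgn a - sgn b) + (norm (sgn a - sgn b) * norm q) * 1"
    using abs_inner_sgn_le[of a q] Cauchy_Schwarz_ineq2[of "sgn a - sgn b" q] norm_sgn_le_1[of b]
    by (intro add_mono mult_mono) auto
  also have "\<dots> \<le> norm q * (4 * norm (b - a) / norm a)"
    using mult_left_mono[OF norm_sgn_diff_le[OF a, of b], of "2 * norm q"]
    by (simp add: norm_minus_commute algebra_simps times_divide_eq_right[symmetric] del: times_divide_eq_right)
  finally have "norm (?P b - ?P a) \<le> norm q * (4 * norm (b - a) / norm a)"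
    by simp
  then have "norm ((1 / norm a) *\<^sub>R (?P b - ?P a)) \<le> 1 / norm a * (norm q * (4 * norm (b - a) / norm a))"
    unfolding norm_scaleR by (intro mult_mono) auto
  then have 2: "norm ((1 / norm a) *\<^sub>R (?P b - ?P a)) \<le> 4 * norm (b - a) * norm q / (norm a)\<^sup>2"
    by (simp add: power2_eq_square algebra_simps)
  have "sgn_deriv b q - sgn_deriv a q
      = (1 / norm b - 1 / norm a) *\<^sub>R ?P b + (1 / norm a) *\<^sub>R (?P b - ?P a)"
    unfolding sgn_deriv_def scaleR_left_diff_distrib scaleR_right_diff_distrib by (simp add: divide_inverse)
  then have "norm (sgn_deriv b q - sgn_deriv a q)
      \<le> norm ((1 / norm b - 1 / norm a) *\<^sub>R ?P b) + norm ((1 / norm a) *\<^sub>R (?P b - ?P a))"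
    by (metis norm_triangle_ineq)
  with 1 2 show ?thesis by simp
qed

text \<open>The mean value inequality for \<open>sgn\<close> on \<open>cball a r\<close>, with the
  derivative frozen at the centre. Both endpoints vary and the error is proportional to
  \<open>norm (q - p)\<close>, as the comparison of two medians requires.\<close>

lemma sgn_linearization_within_ball:
  fixes a p q :: "'a::real_inner"
  assumes r: "0 < r" and a: "2 * r \<le> norm a" and p: "norm p \<le> r" and q: "norm q \<le> r"
  shows "norm (sgn (a + q) - sgn (a + p) - sgn_deriv a (q - p)) \<le> 6 * r * norm (q - p) / (norm a)\<^sup>2"
proof -
  have a0: "a \<noteq> 0" using r a by auto
  have "norm (sgn (a + q) - sgn (a + p) - sgn_deriv a ((a + q) - (a + p)))
      \<le> norm ((a + q) - (a + p)) * (6 * r / (norm a)\<^sup>2)"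
  proof (rule differentiable_bound_linearization[where S = "cball a r" and f' = sgn_deriv])
    fix t :: real assume "t \<in> {0..1}"
    moreover have "a + p \<in> cball a r" "a + q \<in> cball a r"
      using p q by (auto simp: dist_norm)
    ultimately have "(1 - t) *\<^sub>R (a + p) + t *\<^sub>R (a + q) \<in> cball a r"
      by (intro convexD[OF convex_cball]) auto
    then show "a + p + t *\<^sub>R (a + q - (a + p)) \<in> cball a r"
      by (simp add: algebra_simps)
  next
    fix x assume "x \<in> cball a r"
    then have x: "norm (x - a) \<le> r" by (simp add: dist_norm norm_minus_commute)
    have "x \<noteq> 0"
    proof
      assume "x = 0"
      with x r a show False by simp
    qed
    then show "(sgn has_derivative sgn_deriv x) (at x within cball a r)"
      by (rule has_derivative_at_withinI[OF has_derivative_sgn])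
    show "onorm (sgn_deriv x - sgn_deriv a) \<le> 6 * r / (norm a)\<^sup>2"
    proof (rule onorm_bound)
      fix y
      have "norm ((sgn_deriv x - sgn_deriv a) y) \<le> 6 * norm (x - a) * norm y / (norm a)\<^sup>2"
        using norm_sgn_deriv_diff_le[OF a0, of x y] x a by simp
      also have "\<dots> \<le> 6 * r * norm y / (norm a)\<^sup>2"
        using x by (intro divide_right_mono mult_right_mono) auto
      finally show "norm ((sgn_deriv x - sgn_deriv a) y) \<le> 6 * r / (norm a)\<^sup>2 * norm y" by simp
    qed (use r in simp)
  qed (use r in auto)
  then show ?thesis by (simp add: algebra_simps)
qed

text \<open>The bound holds for all \<open>q\<close>: for large \<open>q\<close> every term on the left is itself dominated.\<close>

lemma sgn_linearization:
  fixes a q :: "'a::real_inner"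
  assumes a: "a \<noteq> 0"
  shows "norm (sgn (a + q) - sgn a - sgn_deriv a q) \<le> 10 * (norm q)\<^sup>2 / (norm a)\<^sup>2"
proof -
  consider "q = 0" | "q \<noteq> 0" "2 * norm q \<le> norm a" | "norm a < 2 * norm q" by linarith
  then show ?thesis
  proof cases
    case 1 then show ?thesis by (simp add: sgn_deriv_def)
  next
    case 2
    then have "norm (sgn (a + q) - sgn (a + 0) - sgn_deriv a (q - 0)) \<le> 6 * norm q * norm (q - 0) / (norm a)\<^sup>2"
      by (intro sgn_linearization_within_ball) auto
    also have "\<dots> \<le> 10 * (norm q)\<^sup>2 / (norm a)\<^sup>2"
      by (intro divide_right_mono) (auto simp: power2_eq_square)
    finally show ?thesis by simp
  next
    case 3
    define k where "k = norm q / norm a"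
    have k: "k > 1/2" using 3 a by (simp add: k_def field_simps)
    have "norm (sgn (a + q) - sgn a - sgn_deriv a q)
        \<le> norm (sgn (a + q)) + norm (sgn a) + norm (sgn_deriv a q)"
      using norm_triangle_ineq4[of "sgn (a + q)" "sgn a"]
        norm_triangle_ineq4[of "sgn (a + q) - sgn a" "sgn_deriv a q"] by linarith
    also have "\<dots> \<le> 1 + 1 + k"
      unfolding k_def by (intro add_mono norm_sgn_le_1 norm_sgn_deriv_le)
    \<comment> \<open>As \<open>k > 1/2\<close>, both \<open>2 \<le> 8 * k * k\<close> and
      \<open>k \<le> 2 * k * k\<close> hold; hence the constant 10.\<close>
    also have "\<dots> \<le> 10 * k\<^sup>2"
    proof -
      have "k * (1/2) \<le> k * k" "1/2 * (1/2) \<le> k * k" using k by (intro mult_mono; simp)+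
      then show ?thesis unfolding power2_eq_square by linarith
    qed
    finally show ?thesis by (simp add: k_def power_divide)
  qed
qed

subsection \<open>Measurability of the strategyproofness event\<close>

text \<open>By compactness the uncountable quantifier can be replaced by a countable dense set of
  approximate solutions of finitely many constraints.\<close>

lemma sets_Collect_Bex_compact:
  fixes K :: "'b::euclidean_space set" and h :: "nat \<Rightarrow> 'a \<Rightarrow> 'b \<Rightarrow> real"
  assumes K: "compact K"
    and meas[measurable]: "\<And>i x. (\<lambda>\<omega>. h i \<omega> x) \<in> borel_measurable M"
    and cont: "\<And>i \<omega>. continuous_on K (h i \<omega>)"
  shows "{\<omega> \<in> space M. \<exists>x\<in>K. \<forall>i. h i \<omega> x \<le> 0} \<in> sets M"
proof -
  obtain D where D: "countable D" "D \<subseteq> K" "K \<subseteq> closure D"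
    by (rule separable[of K])
  have "(\<exists>x\<in>K. \<forall>i. h i \<omega> x \<le> 0) \<longleftrightarrow> (\<forall>m. \<exists>x\<in>D. \<forall>i\<le>m. h i \<omega> x \<le> 1 / real (Suc m))" (is "?L \<longleftrightarrow> ?R") for \<omega>
  proof
    assume ?L
    then obtain x where x: "x \<in> K" "\<And>i. h i \<omega> x \<le> 0" by blast
    obtain d where d: "\<And>n. d n \<in> D" "d \<longlonglongrightarrow> x"
      using x D(3) by (force simp: closure_sequential)
    show ?R
    proof
      fix m
      have "\<forall>\<^sub>F n in sequentially. h i \<omega> (d n) < 1 / real (Suc m)" for i
      proof (rule order_tendstoD)
        show "(\<lambda>n. h i \<omega> (d n)) \<longlonglongrightarrow> h i \<omega> x"
          using d(1) D(2) by (intro continuous_on_tendsto_compose[OF cont d(2) x(1)]) (auto intro: always_eventually)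
        show "h i \<omega> x < 1 / real (Suc m)"
          using x(2)[of i] by (rule le_less_trans) simp
      qed
      then have "\<forall>\<^sub>F n in sequentially. \<forall>i\<in>{..m}. h i \<omega> (d n) < 1 / real (Suc m)"
        by (intro eventually_ball_finite) auto
      then obtain n where "\<forall>i\<in>{..m}. h i \<omega> (d n) < 1 / real (Suc m)"
        by (auto simp: eventually_sequentially)
      then show "\<exists>x\<in>D. \<forall>i\<le>m. h i \<omega> x \<le> 1 / real (Suc m)"
        using d(1) by (intro bexI[of _ "d n"]) (auto intro: less_imp_le)
    qed
  next
    assume ?R
    then obtain x where x: "\<And>m. x m \<in> D" "\<And>m i. i \<le> m \<Longrightarrow> h i \<omega> (x m) \<le> 1 / real (Suc m)"
      using choice[of "\<lambda>m x. x \<in> D \<and> (\<forall>i\<le>m. h i \<omega> x \<le> 1 / real (Suc m))"] by blast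
    \<comment> \<open>A limit point satisfies each constraint exactly: from index \<open>i\<close>
      on, constraint \<open>i\<close> holds up to a vanishing tolerance.\<close>
    obtain l r where l: "l \<in> K" "strict_mono r" "(x \<circ> r) \<longlonglongrightarrow> l"
      using K x(1) D(2) unfolding compact_eq_seq_compact_metric by (elim seq_compactE) auto
    have "h i \<omega> l \<le> 0" for i
    proof (rule LIMSEQ_le)
      show "(\<lambda>n. h i \<omega> ((x \<circ> r) n)) \<longlonglongrightarrow> h i \<omega> l"
        using x(1) D(2) by (intro continuous_on_tendsto_compose[OF cont l(3) l(1)]) (auto intro: always_eventually)
      show "(\<lambda>n. 1 / real (Suc (r n))) \<longlonglongrightarrow> 0"
        using LIMSEQ_subseq_LIMSEQ[OF LIMSEQ_inverse_real_of_nat l(2)]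
        by (simp add: o_def inverse_eq_divide)
      show "\<exists>N. \<forall>n\<ge>N. h i \<omega> ((x \<circ> r) n) \<le> 1 / real (Suc (r n))"
        using x(2) seq_suble[OF l(2)] by (metis comp_apply order_trans)
    qed
    with l(1) show ?L by blast
  qed
  then show ?thesis
    using D(1) by simp
qed

lemma continuous_on_gm_loss [continuous_intros]:
  "continuous_on S f \<Longrightarrow> continuous_on S g \<Longrightarrow> continuous_on S (\<lambda>x. gm_loss V \<theta> (f x) (g x))"
  unfolding gm_loss_def by (intro continuous_intros)

lemma measurable_gm_loss:
  assumes "sets M = sets borel"
  shows "(\<lambda>\<theta>. gm_loss V \<theta> s z) \<in> borel_measurable (Pi\<^sub>M {1..V} (\<lambda>_. M))"
proof -
  have [measurable]: "(\<lambda>\<theta>. \<theta> v) \<in> borel_measurable (Pi\<^sub>M {1..V} (\<lambda>_. M))" if "v \<in> {1..V}" for v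
    using measurable_component_singleton[OF that, of "\<lambda>_. M"] measurable_cong_sets[OF refl assms] by blast
  show ?thesis
    unfolding gm_loss_def by measurable
qed

text \<open>Continuity of the loss reduces minimality to countably many inequalities, the form that
  the compactness argument accepts.\<close>

lemma is_Gm_iff_dense:
  assumes "closure (range z) = UNIV"
  shows "is_Gm V \<theta> s x \<longleftrightarrow> (\<forall>i. gm_loss V \<theta> s x \<le> gm_loss V \<theta> s (z i))"
proof
  assume *: "\<forall>i. gm_loss V \<theta> s x \<le> gm_loss V \<theta> s (z i)"
  have "gm_loss V \<theta> s x \<le> gm_loss V \<theta> s y" for y
  proof (rule continuous_ge_on_closure[of "range z" "gm_loss V \<theta> s"])
    show "continuous_on (closure (range z)) (gm_loss V \<theta> s)"
      by (intro continuous_on_gm_loss continuous_on_const continuous_on_id)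
  qed (use * assms in auto)
  then show "is_Gm V \<theta> s x"
    by (auto simp: is_Gm_def is_arg_min_def not_less)
qed (auto simp: is_Gm_def is_arg_min_def not_less)

text \<open>A failure of the bound is an existential statement over four points. Restricting to
  balls and turning the strict violation into a gap makes it a countable union of compact
  problems.\<close>

lemma sets_strategyproof_event:
  fixes M :: "(real ^ 'n) measure"
  assumes M: "sets M = sets borel"
  shows "{\<theta> \<in> space (Pi\<^sub>M {1..V} (\<lambda>_. M)).
      \<forall>t s x y. is_Gm V \<theta> t x \<longrightarrow> is_Gm V \<theta> s y \<longrightarrow> norm (x - t) \<le> C * norm (y - t)}
    \<in> sets (Pi\<^sub>M {1..V} (\<lambda>_. M))" (is "{\<theta> \<in> space ?P. ?Q \<theta>} \<in> _")
proof -
  obtain Z :: "(real ^ 'n) set" where Z: "countable Z" "Z \<subseteq> UNIV" "UNIV \<subseteq> closure Z"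
    by (rule separable[of "UNIV :: (real ^ 'n) set"])
  have "Z \<noteq> {}" 
  proof
    assume "Z = {}"
    with Z(3) show False by simp
  qed
  define z where "z = from_nat_into Z"
  have z: "range z = Z"
    unfolding z_def by (rule range_from_nat_into) fact+
  \<comment> \<open>One \<open>max\<close> encodes both minimality tests against \<open>z i\<close>
    and a violation by at least \<open>1 / real (Suc n)\<close>, so every constraint is closed. The
    same \<open>n\<close> later bounds the four points.\<close>
  define h where "h n i \<theta> = (\<lambda>(t, s, x, y). max (max (gm_loss V \<theta> t x - gm_loss V \<theta> t (z i))
      (gm_loss V \<theta> s y - gm_loss V \<theta> s (z i))) (C * norm (y - t) + 1 / real (Suc n) - norm (x - t)))"
    for n i \<theta>
  have h: "h n i \<theta> (t, s, x, y) \<le> 0 \<longleftrightarrow> gm_loss V \<theta> t x \<le> gm_loss V \<theta> t (z i) \<and>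
      gm_loss V \<theta> s y \<le> gm_loss V \<theta> s (z i) \<and> C * norm (y - t) + 1 / real (Suc n) \<le> norm (x - t)" for n i \<theta> t s x y
    by (auto simp: h_def)
  have Gm: "is_Gm V \<theta> s x \<longleftrightarrow> (\<forall>i. gm_loss V \<theta> s x \<le> gm_loss V \<theta> s (z i))" for \<theta> s x
    using Z z by (intro is_Gm_iff_dense) auto
  have "{\<theta> \<in> space ?P. \<exists>p\<in>cball 0 (real n). \<forall>i. h n i \<theta> p \<le> 0} \<in> sets ?P" for n
  proof (rule sets_Collect_Bex_compact[OF compact_cball])
    show "(\<lambda>\<theta>. h n i \<theta> p) \<in> borel_measurable ?P" for i p
      unfolding h_def using measurable_gm_loss[OF M] by (cases p) simp
    show "continuous_on (cball 0 (real n)) (h n i \<theta>)" for i \<theta>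
      unfolding h_def case_prod_beta by (intro continuous_intros)
  qed
  then have "(\<Union>n. {\<theta> \<in> space ?P. \<exists>p\<in>cball 0 (real n). \<forall>i. h n i \<theta> p \<le> 0}) \<in> sets ?P"
    by blast
  moreover have "(\<exists>n. \<exists>p\<in>cball 0 (real n). \<forall>i. h n i \<theta> p \<le> 0) \<longleftrightarrow> \<not> ?Q \<theta>" for \<theta>
  proof
    assume "\<exists>n. \<exists>p\<in>cball 0 (real n). \<forall>i. h n i \<theta> p \<le> 0"
    then obtain n t s x y where *: "\<And>i. h n i \<theta> (t, s, x, y) \<le> 0" by (metis surj_pair)
    then have "is_Gm V \<theta> t x" "is_Gm V \<theta> s y" "C * norm (y - t) + 1 / real (Suc n) \<le> norm (x - t)"
      unfolding h Gm by blast+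
    moreover from this(3) have "\<not> norm (x - t) \<le> C * norm (y - t)"
      using of_nat_0_less_iff[of "Suc n"] by (smt (verit) divide_pos_pos zero_less_Suc)
    ultimately show "\<not> ?Q \<theta>" by blast
  next
    assume "\<not> ?Q \<theta>"
    then obtain t s x y where *: "is_Gm V \<theta> t x" "is_Gm V \<theta> s y" "C * norm (y - t) < norm (x - t)"
      by (auto simp: not_le)
    have "\<forall>\<^sub>F n in sequentially. 1 / real (Suc n) < norm (x - t) - C * norm (y - t)"
      using LIMSEQ_inverse_real_of_nat *(3) by (intro order_tendstoD) (auto simp: inverse_eq_divide)
    moreover have "\<forall>\<^sub>F n in sequentially. norm (t, s, x, y) \<le> real n"
      using filterlim_real_sequentially by (auto simp: filterlim_at_top)
    ultimately have "\<forall>\<^sub>F n in sequentially. 1 / real (Suc n) < norm (x - t) - C * norm (y - t) \<and> norm (t, s, x, y) \<le> real n"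
      by (rule eventually_conj)
    then obtain n where n: "1 / real (Suc n) < norm (x - t) - C * norm (y - t)" "norm (t, s, x, y) \<le> real n"
      by (auto simp: eventually_sequentially)
    have "\<forall>i. h n i \<theta> (t, s, x, y) \<le> 0"
      using n(1) *(1,2) unfolding h Gm by (auto simp del: of_nat_Suc)
    then show "\<exists>n. \<exists>p\<in>cball 0 (real n). \<forall>i. h n i \<theta> p \<le> 0"
      using n(2) by (intro exI[of _ n] bexI[of _ "(t, s, x, y)"]) auto
  qed
  then have "(\<Union>n. {\<theta> \<in> space ?P. \<exists>p\<in>cball 0 (real n). \<forall>i. h n i \<theta> p \<le> 0}) = {\<theta> \<in> space ?P. \<not> ?Q \<theta>}"
    by blast
  ultimately have "{\<theta> \<in> space ?P. \<not> ?Q \<theta>} \<in> sets ?P"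
    by simp
  from sets.compl_sets[OF this] show ?thesis
    by (rule back_subst) auto
qed

subsection \<open>Second moments of sums of independent samples\<close>

lemma
  fixes f :: "'a \<Rightarrow> 'b::{banach, second_countable_topology}"
  assumes "prob_space M" "i \<in> I" and f[measurable]: "f \<in> borel_measurable M"
  shows integral_PiM_component: "(\<integral>\<omega>. f (\<omega> i) \<partial>Pi\<^sub>M I (\<lambda>_. M)) = (\<integral>x. f x \<partial>M)"
    and integrable_PiM_component:
      "integrable (Pi\<^sub>M I (\<lambda>_. M)) (\<lambda>\<omega>. f (\<omega> i)) \<longleftrightarrow> integrable M f"
proof -
  have d: "distr (Pi\<^sub>M I (\<lambda>_. M)) M (\<lambda>\<omega>. \<omega> i) = M"
    using assms by (intro distr_PiM_component)
  show "(\<integral>\<omega>. f (\<omega> i) \<partial>Pi\<^sub>M I (\<lambda>_. M)) = (\<integral>x. f x \<partial>M)"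
    using integral_distr[of "\<lambda>\<omega>. \<omega> i" "Pi\<^sub>M I (\<lambda>_. M)" M f] assms(2) d by simp
  show "integrable (Pi\<^sub>M I (\<lambda>_. M)) (\<lambda>\<omega>. f (\<omega> i)) \<longleftrightarrow> integrable M f"
    using integrable_distr_eq[of "\<lambda>\<omega>. \<omega> i" "Pi\<^sub>M I (\<lambda>_. M)" M f] assms(2) d by simp
qed

text \<open>After expanding the square, the cross terms factor by independence and vanish by
  \<open>mean\<close>; each index leaves one second moment.\<close>

lemma
  fixes f :: "'a \<Rightarrow> real"
  assumes M: "prob_space M" and I: "finite I" and f[measurable]: "f \<in> borel_measurable M"
    and sq: "integrable M (\<lambda>x. (f x)\<^sup>2)" and mean: "(\<integral>x. f x \<partial>M) = 0"
  shows integrable_sum_square_PiM: "integrable (Pi\<^sub>M I (\<lambda>_. M)) (\<lambda>\<omega>. (\<Sum>i\<in>I. f (\<omega> i))\<^sup>2)"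
    and integral_sum_square_PiM:
      "(\<integral>\<omega>. (\<Sum>i\<in>I. f (\<omega> i))\<^sup>2 \<partial>Pi\<^sub>M I (\<lambda>_. M)) = card I * (\<integral>x. (f x)\<^sup>2 \<partial>M)"
proof -
  interpret M: prob_space M by fact
  interpret product_prob_space "\<lambda>_. M" I by unfold_locales
  let ?P = "Pi\<^sub>M I (\<lambda>_. M)"
  have int: "integrable M f" using M.square_integrable_imp_integrable[OF f sq] .
  have *: "integrable ?P (\<lambda>\<omega>. f (\<omega> i) * f (\<omega> j)) \<and>
      (\<integral>\<omega>. f (\<omega> i) * f (\<omega> j) \<partial>?P) = (if i = j then \<integral>x. (f x)\<^sup>2 \<partial>M else 0)"
    if ij: "i \<in> I" "j \<in> I" for i j
  proof (cases "i = j")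
    case True
    then show ?thesis
      using integral_PiM_component[OF M ij(1), of "\<lambda>x. (f x)\<^sup>2"] sq
        integrable_PiM_component[OF M ij(1), of "\<lambda>x. (f x)\<^sup>2"] by (simp add: power2_eq_square)
  next
    case False
    \<comment> \<open>Padding with constant factors 1 extends the product of two factors to all of
      \<open>I\<close>, where the product formula for integrals applies.\<close>
    define F where "F k = (if k \<in> {i, j} then f else (\<lambda>_. 1))" for k
    have "(\<lambda>\<omega>. f (\<omega> i) * f (\<omega> j)) = (\<lambda>\<omega>. \<Prod>k\<in>{i, j}. F k (\<omega> k))"
      using False by (simp add: F_def)
    also have "\<dots> = (\<lambda>\<omega>. \<Prod>k\<in>I. F k (\<omega> k))"
      using ij I by (intro ext prod.mono_neutral_left) (auto simp: F_def)
    finally have eq: "(\<lambda>\<omega>. f (\<omega> i) * f (\<omega> j)) = (\<lambda>\<omega>. \<Prod>k\<in>I. F k (\<omega> k))" .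
    have iF: "integrable M (F k)" for k
      using int by (auto simp: F_def)
    have "(\<Prod>k\<in>I. \<integral>x. F k x \<partial>M) = 0"
      using I ij mean by (intro prod_zero) (auto simp: F_def intro!: bexI[of _ i])
    then show ?thesis
      unfolding eq using False product_integral_prod[OF I, of F] product_integrable_prod[OF I, of F] iF by simp
  qed
  have sq: "(\<lambda>\<omega>. (\<Sum>i\<in>I. f (\<omega> i))\<^sup>2) = (\<lambda>\<omega>. \<Sum>i\<in>I. \<Sum>j\<in>I. f (\<omega> i) * f (\<omega> j))"
    by (simp add: power2_eq_square sum_product)
  show "integrable ?P (\<lambda>\<omega>. (\<Sum>i\<in>I. f (\<omega> i))\<^sup>2)"
    unfolding sq using * by (intro Bochner_Integration.integrable_sum) blast
  have "(\<integral>\<omega>. (\<Sum>i\<in>I. f (\<omega> i))\<^sup>2 \<partial>?P) = (\<Sum>i\<in>I. \<Sum>j\<in>I. \<integral>\<omega>. f (\<omega> i) * f (\<omega> j) \<partial>?P)"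
    unfolding sq using * by (subst Bochner_Integration.integral_sum; simp add: Bochner_Integration.integrable_sum)+
  also have "\<dots> = (\<Sum>i\<in>I. \<Sum>j\<in>I. if i = j then \<integral>x. (f x)\<^sup>2 \<partial>M else 0)"
    using * by (intro sum.cong refl) auto
  also have "\<dots> = card I * (\<integral>x. (f x)\<^sup>2 \<partial>M)"
    using I by simp
  finally show "(\<integral>\<omega>. (\<Sum>i\<in>I. f (\<omega> i))\<^sup>2 \<partial>?P) = card I * (\<integral>x. (f x)\<^sup>2 \<partial>M)" .
qed

lemma norm_square_eq_sum_Basis: "(norm x)\<^sup>2 = (\<Sum>b\<in>Basis. (x \<bullet> b)\<^sup>2)"
  for x :: "'a::euclidean_space"
  unfolding power2_norm_eq_inner unfolding power2_eq_square by (rule euclidean_inner)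

text \<open>Reduces to the scalar case coordinate by coordinate. A Euclidean codomain covers both
  unit directions and matrices with the Frobenius norm.\<close>

lemma
  fixes f :: "'a \<Rightarrow> 'b::euclidean_space"
  assumes M: "prob_space M" and I: "finite I" and f[measurable]: "f \<in> borel_measurable M"
    and sq: "integrable M (\<lambda>x. (norm (f x))\<^sup>2)" and mean: "(\<integral>x. f x \<partial>M) = 0"
  shows integrable_norm_sum_square_PiM:
      "integrable (Pi\<^sub>M I (\<lambda>_. M)) (\<lambda>\<omega>. (norm (\<Sum>i\<in>I. f (\<omega> i)))\<^sup>2)"
    and integral_norm_sum_square_PiM:
      "(\<integral>\<omega>. (norm (\<Sum>i\<in>I. f (\<omega> i)))\<^sup>2 \<partial>Pi\<^sub>M I (\<lambda>_. M)) = card I * (\<integral>x. (norm (f x))\<^sup>2 \<partial>M)"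
proof -
  interpret M: prob_space M by fact
  let ?P = "Pi\<^sub>M I (\<lambda>_. M)"
  have "integrable M (\<lambda>x. norm (f x))"
    by (rule M.square_integrable_imp_integrable[OF _ sq]) simp
  then have int: "integrable M f" by (simp add: integrable_norm_iff)
  have sqb: "integrable M (\<lambda>x. (f x \<bullet> b)\<^sup>2)" if "b \<in> Basis" for b
  proof (rule Bochner_Integration.integrable_bound[OF sq])
    show "AE x in M. norm ((f x \<bullet> b)\<^sup>2) \<le> norm ((norm (f x))\<^sup>2)"
      using Basis_le_norm[OF that] by (simp add: abs_le_square_iff[symmetric])
  qed simp
  have meanb: "(\<integral>x. f x \<bullet> b \<partial>M) = 0" for b
    using int mean by simp
  have eq: "(\<lambda>\<omega>. (norm (\<Sum>i\<in>I. f (\<omega> i)))\<^sup>2) = (\<lambda>\<omega>. \<Sum>b\<in>Basis. (\<Sum>i\<in>I. f (\<omega> i) \<bullet> b)\<^sup>2)"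
    by (simp add: norm_square_eq_sum_Basis inner_sum_left)
  have intb: "integrable ?P (\<lambda>\<omega>. (\<Sum>i\<in>I. f (\<omega> i) \<bullet> b)\<^sup>2)" if "b \<in> Basis" for b
    by (rule integrable_sum_square_PiM[OF M I _ sqb[OF that] meanb]) simp
  show "integrable ?P (\<lambda>\<omega>. (norm (\<Sum>i\<in>I. f (\<omega> i)))\<^sup>2)"
    unfolding eq using intb by (intro Bochner_Integration.integrable_sum)
  have "(\<integral>\<omega>. (norm (\<Sum>i\<in>I. f (\<omega> i)))\<^sup>2 \<partial>?P) = (\<Sum>b\<in>Basis. \<integral>\<omega>. (\<Sum>i\<in>I. f (\<omega> i) \<bullet> b)\<^sup>2 \<partial>?P)"
    unfolding eq using intb by (rule Bochner_Integration.integral_sum)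
  also have "\<dots> = (\<Sum>b\<in>Basis. card I * (\<integral>x. (f x \<bullet> b)\<^sup>2 \<partial>M))"
    using integral_sum_square_PiM[OF M I _ sqb meanb] by (intro sum.cong refl) simp
  also have "\<dots> = card I * (\<integral>x. (norm (f x))\<^sup>2 \<partial>M)"
    using sqb by (simp add: norm_square_eq_sum_Basis Bochner_Integration.integral_sum sum_distrib_left)
  finally show "(\<integral>\<omega>. (norm (\<Sum>i\<in>I. f (\<omega> i)))\<^sup>2 \<partial>?P) = card I * (\<integral>x. (norm (f x))\<^sup>2 \<partial>M)" .
qed

subsection \<open>The spatial median of a distribution\<close>

lemma is_arg_min_UNIV: "is_arg_min f (\<lambda>_. True) x \<longleftrightarrow> (\<forall>y. f x \<le> (f y :: real))"
  by (auto simp: is_arg_min_def not_less)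

lemma GDERIV_unique:
  assumes "GDERIV f x :> D" "GDERIV f x :> D'"
  shows "D = D'"
proof -
  have "(\<lambda>h. h \<bullet> D) = (\<lambda>h. h \<bullet> D')"
    using assms unfolding gderiv_def by (rule has_derivative_unique)
  then show ?thesis by (metis vector_eq_ldot)
qed

lemma gradient_eqI: "GDERIV f x :> D \<Longrightarrow> gradient f x = D"
  unfolding gradient_def by (blast intro: GDERIV_unique)

text \<open>Null hyperplanes exclude mass at a point or along a line, since in dimension at least
  two every line lies in a hyperplane. Differentiability of the loss and uniqueness of the median
  rest on this.\<close>

locale spatial_distribution = prob_space M for M :: "(real ^ 'n) measure" +
  assumes sets_M [measurable_cong]: "sets M = sets borel"
    and first_moment: "integrable M norm"
    and null_hyperplane: "a \<noteq> 0 \<Longrightarrow> AE \<theta> in M. a \<bullet> \<theta> \<noteq> b"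
    and dim_ge_2: "2 \<le> CARD('n)"
begin

section \<open>Integrability and gradient of the population loss\<close>

lemma integrable_norm_diff: "integrable M (\<lambda>\<theta>. norm (z - \<theta>))"
proof (rule Bochner_Integration.integrable_bound)
  show "integrable M (\<lambda>\<theta>. norm z + norm \<theta>)"
    using first_moment by (intro Bochner_Integration.integrable_add) simp_all
  show "AE \<theta> in M. norm (norm (z - \<theta>)) \<le> norm (norm z + norm \<theta>)"
    by (auto intro: norm_triangle_ineq4)
qed simp

lemma integrable_sgn: "integrable M (\<lambda>\<theta>. sgn (z - \<theta>))"
  by (rule integrable_const_bound[of _ 1]) (auto simp: norm_sgn)

lemma AE_neq: "AE \<theta> in M. \<theta> \<noteq> z"
proof -
  have "AE \<theta> in M. axis undefined 1 \<bullet> \<theta> \<noteq> axis undefined 1 \<bullet> z"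
    by (rule null_hyperplane) (simp add: axis_eq_0_iff)
  then show ?thesis by eventually_elim auto
qed

text \<open>Subgradient inequalities at both ends of a step \<open>h\<close> trap the remainder
  between 0 and the change of direction paired with \<open>h\<close>. The mean change of direction
  tends to 0 by dominated convergence, as \<open>sgn\<close> is continuous away from the null event
  \<open>\<theta> = z\<close>.\<close>

lemma GDERIV_L_inf: "GDERIV (L_inf M) z :> (\<integral>\<theta>. sgn (z - \<theta>) \<partial>M)"
proof -
  let ?D = "\<integral>\<theta>. sgn (z - \<theta>) \<partial>M"
  define \<omega> where "\<omega> h = (\<integral>\<theta>. norm (sgn (z + h - \<theta>) - sgn (z - \<theta>)) \<partial>M)" for h
  have int\<omega>: "integrable M (\<lambda>\<theta>. norm (sgn (z + h - \<theta>) - sgn (z - \<theta>)))" for h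
    by (intro integrable_norm Bochner_Integration.integrable_diff integrable_sgn)
  have le: "norm (L_inf M (z + h) - L_inf M z - h \<bullet> ?D) \<le> \<omega> h * norm h" for h
  proof -
    have int: "integrable M (\<lambda>\<theta>. norm (z + h - \<theta>) - norm (z - \<theta>) - h \<bullet> sgn (z - \<theta>))"
      by (intro Bochner_Integration.integrable_diff integrable_norm_diff integrable_inner_right integrable_sgn)
    have "L_inf M (z + h) - L_inf M z - h \<bullet> ?D
        = (\<integral>\<theta>. norm (z + h - \<theta>) - norm (z - \<theta>) - h \<bullet> sgn (z - \<theta>) \<partial>M)"
      unfolding L_inf_def using integrable_norm_diff integrable_sgn by simp
    then have "norm (L_inf M (z + h) - L_inf M z - h \<bullet> ?D)
        \<le> (\<integral>\<theta>. norm (norm (z + h - \<theta>) - norm (z - \<theta>) - h \<bullet> sgn (z - \<theta>)) \<partial>M)"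
      by (simp only: integral_norm_bound)
    also have "\<dots> \<le> (\<integral>\<theta>. norm (sgn (z + h - \<theta>) - sgn (z - \<theta>)) * norm h \<partial>M)"
    proof (intro integral_mono integrable_norm int integrable_mult_left int\<omega>)
      fix \<theta>
      let ?a = "z - \<theta>"
      have eq: "z + h - \<theta> = ?a + h" by simp
      have "0 \<le> norm (?a + h) - norm ?a - h \<bullet> sgn ?a"
        using norm_subgradient[of ?a "?a + h"] by (simp add: inner_commute)
      moreover have "norm (?a + h) - norm ?a - h \<bullet> sgn ?a \<le> (sgn (?a + h) - sgn ?a) \<bullet> h"
        using norm_subgradient[of "?a + h" ?a] by (simp add: inner_diff_left inner_diff_right inner_commute)
      moreover have "(sgn (?a + h) - sgn ?a) \<bullet> h \<le> norm (sgn (?a + h) - sgn ?a) * norm h"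
        by (rule norm_cauchy_schwarz)
      ultimately show "norm (norm (z + h - \<theta>) - norm (z - \<theta>) - h \<bullet> sgn (z - \<theta>))
          \<le> norm (sgn (z + h - \<theta>) - sgn (z - \<theta>)) * norm h"
        unfolding eq real_norm_def by linarith
    qed (intro Bochner_Integration.integrable_diff integrable_sgn)
    also have "\<dots> = \<omega> h * norm h"
      unfolding \<omega>_def by simp
    finally show ?thesis .
  qed
  have lim: "\<omega> \<midarrow>0\<rightarrow> 0"
    unfolding tendsto_at_iff_sequentially
  proof (intro allI impI)
    fix X assume X: "X \<longlonglongrightarrow> (0 :: real ^ 'n)"
    have "(\<lambda>i. \<integral>\<theta>. norm (sgn (z + X i - \<theta>) - sgn (z - \<theta>)) \<partial>M) \<longlonglongrightarrow> (\<integral>\<theta>. 0 \<partial>M)"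
    proof (rule integral_dominated_convergence[where w = "\<lambda>_. 2"])
      show "AE \<theta> in M. (\<lambda>i. norm (sgn (z + X i - \<theta>) - sgn (z - \<theta>))) \<longlonglongrightarrow> 0"
        using AE_neq[of z]
      proof eventually_elim
        fix \<theta> assume "\<theta> \<noteq> z"
        moreover have "(\<lambda>i. z + X i - \<theta>) \<longlonglongrightarrow> z + 0 - \<theta>"
          by (intro tendsto_intros X)
        ultimately have "(\<lambda>i. sgn (z + X i - \<theta>)) \<longlonglongrightarrow> sgn (z - \<theta>)"
          by (intro tendsto_sgn) auto
        then show "(\<lambda>i. norm (sgn (z + X i - \<theta>) - sgn (z - \<theta>))) \<longlonglongrightarrow> 0"
          by (simp add: LIM_zero tendsto_norm_zero)
      qed
      show "AE \<theta> in M. norm (norm (sgn (z + X i - \<theta>) - sgn (z - \<theta>))) \<le> 2" for i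
      proof (rule AE_I2)
        fix \<theta>
        show "norm (norm (sgn (z + X i - \<theta>) - sgn (z - \<theta>))) \<le> 2"
          using norm_triangle_ineq4[of "sgn (z + X i - \<theta>)" "sgn (z - \<theta>)"]
            norm_sgn_le_1[of "z + X i - \<theta>"] norm_sgn_le_1[of "z - \<theta>"] by simp
      qed
    qed simp_all
    then show "(\<omega> \<circ> X) \<longlonglongrightarrow> 0"
      by (simp add: \<omega>_def o_def)
  qed
  have "norm (L_inf M (z + h) - L_inf M z - h \<bullet> ?D) / norm h \<le> \<omega> h" if "h \<noteq> 0" for h
    using le[of h] that by (simp add: divide_le_eq)
  then have "(\<lambda>h. norm (L_inf M (z + h) - L_inf M z - h \<bullet> ?D) / norm h) \<midarrow>0\<rightarrow> 0"
    by (intro tendsto_sandwich[OF _ _ tendsto_const lim]) (simp_all add: eventually_at_filter)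
  then show ?thesis
    unfolding gderiv_def has_derivative_at by (simp add: bounded_linear_inner_left)
qed

lemma gradient_L_inf: "gradient (L_inf M) z = (\<integral>\<theta>. sgn (z - \<theta>) \<partial>M)"
  by (rule gradient_eqI[OF GDERIV_L_inf])

section \<open>Existence, uniqueness and location of the population median\<close>

lemma ex_minimizer: "\<exists>g. is_arg_min (L_inf M) (\<lambda>_. True) g"
proof -
  \<comment> \<open>By \<open>lower\<close>, the loss outside this ball exceeds its value at 0, so a
    minimum over the ball is global.\<close>
  let ?R = "2 * L_inf M 0"
  have lower: "norm z - L_inf M 0 \<le> L_inf M z" for z
  proof -
    have "(\<integral>\<theta>. norm z - norm (0 - \<theta>) \<partial>M) \<le> (\<integral>\<theta>. norm (z - \<theta>) \<partial>M)"
      using norm_triangle_ineq2 by (intro integral_mono integrable_norm_diff Bochner_Integration.integrable_diff) auto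
    moreover have "(\<integral>\<theta>. norm z - norm (0 - \<theta>) \<partial>M) = norm z - L_inf M 0"
      unfolding L_inf_def using integrable_norm_diff[of 0] prob_space by simp
    ultimately show ?thesis unfolding L_inf_def by simp
  qed
  have L0: "0 \<le> L_inf M 0" unfolding L_inf_def by simp
  have "continuous_on (cball 0 ?R) (L_inf M)"
    using GDERIV_L_inf unfolding gderiv_def
    by (intro continuous_at_imp_continuous_on ballI has_derivative_continuous)
  then obtain g where g: "\<And>y. y \<in> cball 0 ?R \<Longrightarrow> L_inf M g \<le> L_inf M y"
    using continuous_attains_inf[OF compact_cball, of 0 ?R "L_inf M"] L0 by fastforce
  have "L_inf M g \<le> L_inf M y" for y
  proof (cases "y \<in> cball 0 ?R")
    case False
    then have "L_inf M 0 \<le> L_inf M y" using lower[of y] by simp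
    with g[of 0] L0 show ?thesis by simp
  qed (rule g)
  then show ?thesis unfolding is_arg_min_UNIV by blast
qed

lemma minimizer_stationary:
  assumes "is_arg_min (L_inf M) (\<lambda>_. True) g"
  shows "(\<integral>\<theta>. sgn (g - \<theta>) \<partial>M) = 0"
proof -
  have "(\<lambda>h. h \<bullet> (\<integral>\<theta>. sgn (g - \<theta>) \<partial>M)) = (\<lambda>_. 0)"
    using assms GDERIV_L_inf[of g]
    by (intro differential_zero_maxmin[of g UNIV "L_inf M"]) (auto simp: gderiv_def is_arg_min_UNIV)
  then show ?thesis by (metis inner_eq_zero_iff)
qed

text \<open>With two minimizers the subgradient inequality at the first is tight almost surely,
  which forces voters onto the line through both, a null set.\<close>

lemma minimizer_unique:
  assumes g: "is_arg_min (L_inf M) (\<lambda>_. True) g" and g': "is_arg_min (L_inf M) (\<lambda>_. True) g'"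
  shows "g' = g"
proof (rule ccontr)
  assume neq: "g' \<noteq> g"
  let ?x = "g' - g"
  let ?f = "\<lambda>\<theta>. norm (g' - \<theta>) - norm (g - \<theta>) - ?x \<bullet> sgn (g - \<theta>)"
  have int: "integrable M ?f"
    by (intro Bochner_Integration.integrable_diff integrable_norm_diff integrable_inner_right integrable_sgn)
  have "(\<integral>\<theta>. ?f \<theta> \<partial>M) = L_inf M g' - L_inf M g - ?x \<bullet> (\<integral>\<theta>. sgn (g - \<theta>) \<partial>M)"
    unfolding L_inf_def using integrable_norm_diff integrable_sgn by simp
  also have "\<dots> = 0"
    using g g' minimizer_stationary[OF g] by (simp add: is_arg_min_UNIV antisym)
  finally have "(\<integral>\<theta>. ?f \<theta> \<partial>M) = 0" .
  moreover have "0 \<le> ?f \<theta>" for \<theta>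
    using norm_subgradient[of "g - \<theta>" "g' - \<theta>"] by (simp add: inner_commute)
  ultimately have f0: "AE \<theta> in M. ?f \<theta> = 0"
    using integral_nonneg_eq_0_iff_AE[OF int] by simp
  \<comment> \<open>The hyperplane through \<open>g\<close> with normal \<open>b\<close> contains
    the line through both minimizers.\<close>
  obtain b where b: "b \<noteq> 0" "orthogonal ?x b"
    using orthogonal_to_vector_exists[of ?x] dim_ge_2 by auto
  have "AE \<theta> in M. False"
    using f0 AE_neq[of g] null_hyperplane[OF b(1), of "b \<bullet> g"]
  proof eventually_elim
    case (elim \<theta>)
    let ?a = "g - \<theta>" and ?y = "g' - \<theta>"
    have a: "?a \<noteq> 0" using elim by simp
    have y: "?y = ?a + ?x" by simp
    have bx: "b \<bullet> ?x = 0" using b(2) by (simp add: orthogonal_def inner_commute)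
    have n: "sgn ?a \<bullet> ?y = norm ?y"
      using elim unfolding y inner_add_right inner_sgn_self by (simp add: inner_commute)
    then have par: "?y = (sgn ?a \<bullet> ?y) *\<^sub>R sgn ?a"
      using a by (intro parallel_sgn) simp_all
    then have "?y = (norm ?y / norm ?a) *\<^sub>R ?a"
      unfolding n by (simp add: sgn_div_norm divide_inverse)
    moreover define c where "c = norm ?y / norm ?a"
    ultimately have "?y = c *\<^sub>R ?a" by simp
    then have c: "?x = (c - 1) *\<^sub>R ?a"
      unfolding y by (simp add: algebra_simps)
    then have "c \<noteq> 1" using neq by auto
    then have "b \<bullet> ?a = 0" using bx unfolding c by simp
    with elim show False by (simp add: inner_diff_right)
  qed
  then show False by simp
qed

lemma is_arg_min_g_inf: "is_arg_min (L_inf M) (\<lambda>_. True) (g_inf M)"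
  unfolding g_inf_def using ex_minimizer minimizer_unique by (metis theI)

lemma mean_direction_g_inf: "(\<integral>\<theta>. sgn (g_inf M - \<theta>) \<partial>M) = 0"
  by (rule minimizer_stationary[OF is_arg_min_g_inf])

text \<open>Otherwise a hyperplane through the median would have all the mass strictly on one side,
  and moving towards it would decrease the loss.\<close>

lemma g_inf_in_convex:
  assumes "convex S" and S: "AE \<theta> in M. \<theta> \<in> S"
  shows "g_inf M \<in> S"
proof (rule ccontr)
  assume "g_inf M \<notin> S"
  let ?g = "g_inf M"
  have "S \<noteq> {}" using S by auto
  then obtain a b where a: "a \<noteq> 0" "\<And>x. x \<in> {?g} \<Longrightarrow> a \<bullet> x \<le> b" "\<And>x. x \<in> S \<Longrightarrow> b \<le> a \<bullet> x"
    using separating_hyperplane_sets[of "{?g}" S] \<open>?g \<notin> S\<close> \<open>convex S\<close> by auto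
  have le: "a \<bullet> ?g \<le> a \<bullet> x" if "x \<in> S" for x using a(2)[of ?g] a(3)[OF that] by simp
  \<comment> \<open>Stationarity paired with \<open>- a\<close>: a nonnegative integrand of mean
    zero vanishes almost surely, putting the voters on the null separating hyperplane.\<close>
  let ?f = "\<lambda>\<theta>. (- a) \<bullet> sgn (?g - \<theta>)"
  have int: "integrable M ?f" by (intro integrable_inner_right integrable_sgn)
  have f: "?f \<theta> = (a \<bullet> \<theta> - a \<bullet> ?g) / norm (?g - \<theta>)" for \<theta>
    by (simp add: sgn_div_norm inner_diff_right divide_inverse algebra_simps)
  have "AE \<theta> in M. 0 \<le> ?f \<theta>"
    using S
  proof eventually_elim
    case (elim \<theta>)
    then show ?case unfolding f using le[OF elim] by (intro divide_nonneg_nonneg) auto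
  qed
  moreover have "(\<integral>\<theta>. ?f \<theta> \<partial>M) = 0"
    using mean_direction_g_inf integrable_sgn by simp
  ultimately have "AE \<theta> in M. ?f \<theta> = 0"
    using integral_nonneg_eq_0_iff_AE[OF int] by simp
  then have "AE \<theta> in M. False"
    using null_hyperplane[OF a(1), of "a \<bullet> ?g"] AE_neq[of ?g]
  proof eventually_elim
    case (elim \<theta>)
    then show False unfolding f by simp
  qed
  then show False by simp
qed

end

subsection \<open>The Hessian at the median\<close>

text \<open>The matrix of \<open>sgn_deriv a\<close>. As an element of a Euclidean space it can be
  averaged, and the variance bound for sums applies to it.\<close>

definition sgn_matrix :: "real ^ 'n \<Rightarrow> real ^ 'n ^ 'n" where
  "sgn_matrix a = (\<chi> i j. ((if i = j then 1 else 0) - sgn a $ i * sgn a $ j) / norm a)"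

lemma sgn_matrix_mult: "sgn_matrix a *v q = sgn_deriv a q"
proof -
  have "(sgn_matrix a *v q) $ i = sgn_deriv a q $ i" for i
  proof -
    have "(sgn_matrix a *v q) $ i
        = (\<Sum>j\<in>UNIV. ((if i = j then q $ j else 0) - sgn a $ i * (sgn a $ j * q $ j)) / norm a)"
      unfolding sgn_matrix_def matrix_vector_mult_def
      by (auto intro!: sum.cong simp: algebra_simps)
    also have "\<dots> = (q $ i - sgn a $ i * (sgn a \<bullet> q)) / norm a"
      by (simp add: sum_divide_distrib[symmetric] sum_subtractf sum_distrib_left[symmetric] inner_vec_def)
    finally show ?thesis
      by (simp add: sgn_deriv_def divide_inverse algebra_simps)
  qed
  then show ?thesis by (simp add: vec_eq_iff)
qed

lemma norm_matrix_le_sum: "norm (A :: real ^ 'n ^ 'm) \<le> (\<Sum>i\<in>UNIV. \<Sum>j\<in>UNIV. \<bar>A $ i $ j\<bar>)"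
proof -
  have "norm A \<le> (\<Sum>i\<in>UNIV. norm (A $ i))"
    unfolding norm_vec_def[of A] by (rule L2_set_le_sum) simp
  also have "\<dots> \<le> (\<Sum>i\<in>UNIV. \<Sum>j\<in>UNIV. \<bar>A $ i $ j\<bar>)"
    by (intro sum_mono norm_le_l1_cart)
  finally show ?thesis .
qed

text \<open>The norm of a matrix is the Frobenius norm here, which dominates the operator norm by
  Cauchy-Schwarz in each row.\<close>

lemma norm_matrix_vector_mult_le: "norm (A *v x) \<le> norm A * norm (x :: real ^ 'n)"
  for A :: "real ^ 'n ^ 'm"
proof -
  have "norm (A *v x) \<le> L2_set (\<lambda>i. norm (A $ i) * norm x) UNIV"
    unfolding norm_vec_def[of "A *v x"]
  proof (rule L2_set_mono)
    fix i
    show "norm ((A *v x) $ i) \<le> norm (A $ i) * norm x"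
      using Cauchy_Schwarz_ineq2[of "A $ i" x]
      by (simp add: matrix_vector_mul_component)
  qed simp
  also have "\<dots> = norm A * norm x"
    unfolding norm_vec_def[of A] by (simp add: L2_set_left_distrib)
  finally show ?thesis .
qed

text \<open>A crude bound entry by entry; only the order \<open>1 / norm a\<close> matters, which
  makes the square integrable.\<close>

lemma norm_sgn_matrix_le: "norm (sgn_matrix a) \<le> 2 * (real CARD('n))\<^sup>2 / norm (a :: real ^ 'n)"
proof -
  have e: "\<bar>sgn_matrix a $ i $ j\<bar> \<le> 2 / norm a" for i j
  proof -
    have s: "\<bar>sgn a $ k\<bar> \<le> 1" for k
      using component_le_norm_cart[of "sgn a" k] norm_sgn_le_1[of a] by linarith
    have "\<bar>sgn a $ i * sgn a $ j\<bar> \<le> 1"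
      using mult_mono[OF s[of i] s[of j]] by (simp add: abs_mult)
    then have "\<bar>(if i = j then 1 else 0) - sgn a $ i * sgn a $ j\<bar> \<le> 2"
      by (auto simp: abs_le_iff)
    then show ?thesis unfolding sgn_matrix_def by (simp add: abs_divide divide_right_mono)
  qed
  have "norm (sgn_matrix a) \<le> (\<Sum>i\<in>UNIV. \<Sum>j\<in>UNIV. \<bar>sgn_matrix a $ i $ j\<bar>)"
    by (rule norm_matrix_le_sum)
  also have "\<dots> \<le> (\<Sum>i\<in>(UNIV :: 'n set). \<Sum>j\<in>(UNIV :: 'n set). 2 / norm a)"
    by (intro sum_mono e)
  finally show ?thesis by (simp add: power2_eq_square mult_ac)
qed

lemma borel_measurable_sgn_matrix [measurable]:
  "(sgn_matrix :: real ^ 'n \<Rightarrow> _) \<in> borel_measurable borel"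
proof -
  have [measurable]: "(\<lambda>a :: real ^ 'n. sgn a $ i) \<in> borel_measurable borel" for i
  proof -
    have "(\<lambda>a :: real ^ 'n. sgn a \<bullet> axis i 1) \<in> borel_measurable borel"
      by measurable
    then show ?thesis by (simp add: inner_axis)
  qed
  show ?thesis
    unfolding borel_measurable_euclidean_space[of sgn_matrix]
    by (auto simp: Basis_vec_def inner_axis sgn_matrix_def)
qed

lemma bounded_linear_matrix_vector_mult_left: "bounded_linear (\<lambda>A :: real ^ 'n ^ 'm. A *v x)"
  by (rule bounded_linear_intro[where K = "norm x"])
    (auto simp: matrix_vector_mult_add_rdistrib scaleR_matrix_vector_assoc norm_matrix_vector_mult_le)

text \<open>The inverse square dominates both the second-order remainder of \<open>sgn\<close> and
  the squared norm of \<open>sgn_matrix\<close>.\<close>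

locale regular_spatial_distribution = spatial_distribution M for M :: "(real ^ 'n) measure" +
  assumes inverse_square: "integrable M (\<lambda>\<theta>. 1 / (norm (g_inf M - \<theta>))\<^sup>2)"
begin

section \<open>Identification and positive definiteness of the Hessian\<close>

lemma integrable_sgn_matrix_square: "integrable M (\<lambda>\<theta>. (norm (sgn_matrix (g_inf M - \<theta>)))\<^sup>2)"
proof (rule Bochner_Integration.integrable_bound)
  let ?c = "(2 * (real CARD('n))\<^sup>2)\<^sup>2"
  show "integrable M (\<lambda>\<theta>. ?c * (1 / (norm (g_inf M - \<theta>))\<^sup>2))"
    using inverse_square by (rule integrable_mult_right)
  show "AE \<theta> in M. norm ((norm (sgn_matrix (g_inf M - \<theta>)))\<^sup>2)
      \<le> norm (?c * (1 / (norm (g_inf M - \<theta>))\<^sup>2))"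
  proof (rule AE_I2)
    fix \<theta>
    show "norm ((norm (sgn_matrix (g_inf M - \<theta>)))\<^sup>2) \<le> norm (?c * (1 / (norm (g_inf M - \<theta>))\<^sup>2))"
      using power_mono[OF norm_sgn_matrix_le[of "g_inf M - \<theta>"], of 2] by (simp add: power_divide)
  qed
qed simp

lemma integrable_sgn_matrix: "integrable M (\<lambda>\<theta>. sgn_matrix (g_inf M - \<theta>))"
proof -
  have "integrable M (\<lambda>\<theta>. norm (sgn_matrix (g_inf M - \<theta>)))"
    by (rule square_integrable_imp_integrable[OF _ integrable_sgn_matrix_square]) simp
  then show ?thesis by (simp add: integrable_norm_iff)
qed

lemma
  shows integrable_sgn_deriv: "integrable M (\<lambda>\<theta>. sgn_deriv (g_inf M - \<theta>) q)"
    and mean_sgn_matrix_mult: "(\<integral>\<theta>. sgn_matrix (g_inf M - \<theta>) \<partial>M) *v q = (\<integral>\<theta>. sgn_deriv (g_inf M - \<theta>) q \<partial>M)"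
  using integrable_bounded_linear[OF bounded_linear_matrix_vector_mult_left[of q] integrable_sgn_matrix]
    integral_bounded_linear[OF bounded_linear_matrix_vector_mult_left[of q] integrable_sgn_matrix]
  by (simp_all add: sgn_matrix_mult)

text \<open>Integrating \<open>sgn_linearization\<close> over the voters leaves a remainder
  quadratic in \<open>q\<close>, with the inverse-square moment as its constant.\<close>

lemma has_derivative_gradient_L_inf:
  "(gradient (L_inf M) has_derivative (\<lambda>q. (\<integral>\<theta>. sgn_matrix (g_inf M - \<theta>) \<partial>M) *v q)) (at (g_inf M))"
proof -
  let ?g = "g_inf M" and ?H = "\<integral>\<theta>. sgn_matrix (g_inf M - \<theta>) \<partial>M"
  define c where "c = 10 * (\<integral>\<theta>. 1 / (norm (?g - \<theta>))\<^sup>2 \<partial>M)"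
  have le: "norm (gradient (L_inf M) (?g + q) - gradient (L_inf M) ?g - ?H *v q) \<le> c * (norm q)\<^sup>2" for q
  proof -
    have "gradient (L_inf M) (?g + q) - gradient (L_inf M) ?g - ?H *v q
        = (\<integral>\<theta>. sgn (?g + q - \<theta>) - sgn (?g - \<theta>) - sgn_deriv (?g - \<theta>) q \<partial>M)"
      unfolding gradient_L_inf mean_sgn_matrix_mult
      by (simp add: integrable_sgn integrable_sgn_deriv)
    then have "norm (gradient (L_inf M) (?g + q) - gradient (L_inf M) ?g - ?H *v q)
        \<le> (\<integral>\<theta>. norm (sgn (?g + q - \<theta>) - sgn (?g - \<theta>) - sgn_deriv (?g - \<theta>) q) \<partial>M)"
      by (simp only: integral_norm_bound)
    also have "\<dots> \<le> (\<integral>\<theta>. 10 * (norm q)\<^sup>2 * (1 / (norm (?g - \<theta>))\<^sup>2) \<partial>M)"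
    proof (rule integral_mono_AE)
      show "integrable M (\<lambda>\<theta>. norm (sgn (?g + q - \<theta>) - sgn (?g - \<theta>) - sgn_deriv (?g - \<theta>) q))"
        by (intro integrable_norm Bochner_Integration.integrable_diff integrable_sgn integrable_sgn_deriv)
      show "integrable M (\<lambda>\<theta>. 10 * (norm q)\<^sup>2 * (1 / (norm (?g - \<theta>))\<^sup>2))"
        by (intro integrable_mult_right inverse_square)
      show "AE \<theta> in M. norm (sgn (?g + q - \<theta>) - sgn (?g - \<theta>) - sgn_deriv (?g - \<theta>) q)
          \<le> 10 * (norm q)\<^sup>2 * (1 / (norm (?g - \<theta>))\<^sup>2)"
        using AE_neq[of ?g]
      proof eventually_elim
        case (elim \<theta>)
        then show ?case
          using sgn_linearization[of "?g - \<theta>" q] by (simp add: algebra_simps)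
      qed
    qed
    also have "\<dots> = c * (norm q)\<^sup>2"
      unfolding c_def integral_mult_right_zero by simp
    finally show ?thesis .
  qed
  have quot: "norm (gradient (L_inf M) (?g + q) - gradient (L_inf M) ?g - ?H *v q) / norm q \<le> c * norm q"
    if "q \<noteq> 0" for q
    using le[of q] that by (simp add: divide_le_eq power2_eq_square mult.assoc)
  have lim: "((\<lambda>q :: real ^ 'n. c * norm q) \<longlongrightarrow> 0) (at 0)"
    by (intro tendsto_mult_right_zero tendsto_norm_zero tendsto_ident_at)
  have "(\<lambda>q. norm (gradient (L_inf M) (?g + q) - gradient (L_inf M) ?g - ?H *v q) / norm q) \<midarrow>0\<rightarrow> 0"
    using quot by (intro tendsto_sandwich[OF _ _ tendsto_const lim]) (simp_all add: eventually_at_filter)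
  then show ?thesis
    unfolding has_derivative_at by (simp add: matrix_vector_mul_bounded_linear)
qed

lemma H_inf_eq: "H_inf M = (\<integral>\<theta>. sgn_matrix (g_inf M - \<theta>) \<partial>M)"
  unfolding H_inf_def hessian_def jacobian_def
    frechet_derivative_at[OF has_derivative_gradient_L_inf, symmetric]
  by (rule matrix_of_matrix_vector_mul)

lemma H_inf_mult: "H_inf M *v q = (\<integral>\<theta>. sgn_deriv (g_inf M - \<theta>) q \<partial>M)"
  unfolding H_inf_eq by (rule mean_sgn_matrix_mult)

lemma H_inf_symmetric: "x \<bullet> (H_inf M *v y) = (H_inf M *v x) \<bullet> y"
proof -
  have "x \<bullet> sgn_deriv a y = sgn_deriv a x \<bullet> y" for a
    by (simp add: sgn_deriv_def inner_diff_left inner_diff_right inner_commute)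
  then have "(\<integral>\<theta>. x \<bullet> sgn_deriv (g_inf M - \<theta>) y \<partial>M) = (\<integral>\<theta>. sgn_deriv (g_inf M - \<theta>) x \<bullet> y \<partial>M)"
    by simp
  then show ?thesis
    unfolding H_inf_mult using integrable_sgn_deriv by simp
qed

text \<open>The quadratic form of one voter is nonnegative and vanishes only if the voter lies on
  the line through the median along \<open>x\<close>, a null set.\<close>

lemma H_inf_pos:
  assumes x: "x \<noteq> 0"
  shows "x \<bullet> (H_inf M *v x) > 0"
proof -
  let ?g = "g_inf M"
  let ?f = "\<lambda>\<theta>. x \<bullet> sgn_deriv (?g - \<theta>) x"
  have f: "?f \<theta> = ((norm x)\<^sup>2 - (sgn (?g - \<theta>) \<bullet> x)\<^sup>2) / norm (?g - \<theta>)" for \<theta>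
    unfolding sgn_deriv_def power2_norm_eq_inner
    by (simp add: inner_diff_right inner_commute[of x "sgn _"] power2_eq_square divide_inverse algebra_simps)
  have int: "integrable M ?f" by (intro integrable_inner_right integrable_sgn_deriv)
  have nonneg: "0 \<le> ?f \<theta>" for \<theta>
  proof -
    have "(sgn (?g - \<theta>) \<bullet> x)\<^sup>2 \<le> (norm x)\<^sup>2"
      using abs_inner_sgn_le[of "?g - \<theta>" x] by (simp add: abs_le_square_iff[symmetric])
    then show ?thesis unfolding f by simp
  qed
  have eq: "x \<bullet> (H_inf M *v x) = (\<integral>\<theta>. ?f \<theta> \<partial>M)"
    unfolding H_inf_mult using integrable_sgn_deriv by simp
  have "(\<integral>\<theta>. ?f \<theta> \<partial>M) \<noteq> 0"
  proof
    assume "(\<integral>\<theta>. ?f \<theta> \<partial>M) = 0"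
    then have f0: "AE \<theta> in M. ?f \<theta> = 0"
      using integral_nonneg_eq_0_iff_AE[OF int] nonneg by simp
    obtain b where b: "b \<noteq> 0" "orthogonal x b"
      using orthogonal_to_vector_exists[of x] dim_ge_2 by auto
    have "AE \<theta> in M. False"
      using f0 AE_neq[of ?g] null_hyperplane[OF b(1), of "b \<bullet> ?g"]
    proof eventually_elim
      case (elim \<theta>)
      let ?a = "?g - \<theta>"
      have a: "?a \<noteq> 0" using elim by simp
      have "(sgn ?a \<bullet> x)\<^sup>2 = (norm x)\<^sup>2"
        using elim(1) a unfolding f by simp
      then have par: "x = (sgn ?a \<bullet> x) *\<^sub>R sgn ?a"
        using a by (intro parallel_sgn)
      then have "sgn ?a \<bullet> x \<noteq> 0" using x by auto
      moreover have "(sgn ?a \<bullet> x) * (b \<bullet> sgn ?a) = 0"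
        using b(2) par by (metis inner_commute inner_scaleR_right orthogonal_def)
      ultimately have "b \<bullet> ?a = 0"
        using a by (simp add: sgn_div_norm)
      with elim(3) show False by (simp add: inner_diff_right)
    qed
    then show False by simp
  qed
  moreover have "0 \<le> (\<integral>\<theta>. ?f \<theta> \<partial>M)" using nonneg by simp
  ultimately show ?thesis unfolding eq by simp
qed

end

section \<open>Positive definite matrices and their skewness\<close>

lemma pos_def_matrix_lower_bound:
  fixes H :: "real ^ 'n ^ 'n"
  assumes pos: "\<And>x. x \<noteq> 0 \<Longrightarrow> x \<bullet> (H *v x) > 0"
  shows "\<exists>\<kappa>>0. \<forall>x. x \<bullet> (H *v x) \<ge> \<kappa> * (norm x)\<^sup>2"
proof -
  let ?S = "sphere (0 :: real ^ 'n) 1"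
  have "continuous_on ?S (\<lambda>x. x \<bullet> (H *v x))"
    by (intro continuous_intros)
  moreover have "axis undefined 1 \<in> ?S" by simp
  then have "?S \<noteq> {}" by blast
  ultimately obtain u where u: "u \<in> ?S" "\<And>y. y \<in> ?S \<Longrightarrow> u \<bullet> (H *v u) \<le> y \<bullet> (H *v y)"
    using continuous_attains_inf[OF compact_sphere, of 0 1 "\<lambda>x. x \<bullet> (H *v x)"] by auto
  have "x \<bullet> (H *v x) \<ge> u \<bullet> (H *v u) * (norm x)\<^sup>2" for x
  proof (cases "x = 0")
    case False
    have "u \<bullet> (H *v u) \<le> sgn x \<bullet> (H *v sgn x)"
      using False by (intro u) (simp add: norm_sgn)
    also have "\<dots> = (x \<bullet> (H *v x)) / (norm x)\<^sup>2"
      by (simp add: sgn_div_norm matrix_vector_mult_scaleR power2_eq_square divide_inverse)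
    finally show ?thesis using False by (simp add: le_divide_eq)
  qed simp
  moreover have "u \<bullet> (H *v u) > 0" using u(1) by (intro pos) auto
  ultimately show ?thesis by blast
qed

text \<open>The lower bound \<open>\<kappa>\<close> keeps the quotients below
  \<open>norm H / \<kappa>\<close>, so the real supremum in \<open>Skew\<close> does bound
  them.\<close>

lemma
  fixes H :: "real ^ 'n ^ 'n"
  assumes pos: "\<And>x. x \<noteq> 0 \<Longrightarrow> x \<bullet> (H *v x) > 0"
  shows Skew_upper: "norm x * norm (H *v x) \<le> (1 + Skew H) * (x \<bullet> (H *v x))"
    and Skew_nonneg: "0 \<le> Skew H"
proof -
  let ?f = "\<lambda>x. norm x * norm (H *v x) / (x \<bullet> (H *v x)) - 1"
  obtain \<kappa> where \<kappa>: "\<kappa> > 0" "\<And>x. x \<bullet> (H *v x) \<ge> \<kappa> * (norm x)\<^sup>2"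
    using pos_def_matrix_lower_bound[OF pos] by blast
  have bdd: "bdd_above (?f ` {x. x \<noteq> 0})"
  proof (rule bdd_aboveI2)
    fix x assume "x \<in> {x :: real ^ 'n. x \<noteq> 0}"
    then have x: "x \<noteq> 0" by simp
    have "norm x * norm (H *v x) / (x \<bullet> (H *v x)) \<le> norm x * (norm H * norm x) / (\<kappa> * (norm x)\<^sup>2)"
      using x \<kappa> by (intro frac_le mult_left_mono norm_matrix_vector_mult_le) auto
    also have "\<dots> = norm H / \<kappa>"
      using x \<kappa>(1) by (simp add: power2_eq_square)
    finally show "?f x \<le> norm H / \<kappa>" by simp
  qed
  have up: "?f x \<le> Skew H" if "x \<noteq> 0" for x
    unfolding Skew_def using bdd that by (intro cSUP_upper) auto
  show "norm x * norm (H *v x) \<le> (1 + Skew H) * (x \<bullet> (H *v x))"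
  proof (cases "x = 0")
    case False
    then show ?thesis using up[OF False] pos[OF False] by (simp add: field_simps)
  qed simp
  have ax: "axis undefined 1 \<noteq> (0 :: real ^ 'n)" by (simp add: axis_eq_0_iff)
  have "0 \<le> ?f (axis undefined 1)"
    using pos[OF ax] norm_cauchy_schwarz[of "axis undefined 1" "H *v axis undefined 1"]
    by (simp add: le_divide_eq)
  then show "0 \<le> Skew H" using up[OF ax] by linarith
qed

subsection \<open>Empirical medians of a well-behaved sample\<close>

lemma is_Gm_iff:
  "is_Gm V \<theta> s x \<longleftrightarrow> (\<forall>z. norm (x - s) + (\<Sum>v=1..V. norm (x - \<theta> v)) \<le> norm (z - s) + (\<Sum>v=1..V. norm (z - \<theta> v)))"
  by (simp add: is_Gm_def is_arg_min_UNIV gm_loss_def mult_le_cancel_left divide_le_cancel)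

text \<open>The distance to \<open>s\<close> is 1-Lipschitz, so a median minimizes the other voters'
  sum up to a unit slope. This is all that is used about an untruthful report.\<close>

lemma is_Gm_sum_le:
  assumes "is_Gm V \<theta> s x"
  shows "(\<Sum>v=1..V. norm (x - \<theta> v)) \<le> (\<Sum>v=1..V. norm (z - \<theta> v)) + norm (z - x)"
proof -
  have "norm (x - s) + (\<Sum>v=1..V. norm (x - \<theta> v)) \<le> norm (z - s) + (\<Sum>v=1..V. norm (z - \<theta> v))"
    using assms unfolding is_Gm_iff by blast
  moreover have "norm (z - s) \<le> norm (z - x) + norm (x - s)"
    using norm_triangle_ineq[of "z - x" "x - s"] by simp
  ultimately show ?thesis by linarith
qed

lemma has_derivative_norm_diff:
  fixes x c :: "'a::real_inner"
  assumes "x \<noteq> c"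
  shows "((\<lambda>z. norm (z - c)) has_derivative (\<lambda>h. h \<bullet> sgn (x - c))) (at x)"
proof -
  have "((\<lambda>z. z - c) has_derivative (\<lambda>h. h)) (at x)"
    by (auto intro!: derivative_eq_intros)
  from has_derivative_compose[OF this has_derivative_norm] show ?thesis
    using assms by simp
qed

lemma has_derivative_sum_norm_diff:
  fixes x :: "'a::real_inner"
  assumes "\<And>v. v \<in> I \<Longrightarrow> x \<noteq> \<theta> v"
  shows "((\<lambda>z. \<Sum>v\<in>I. norm (z - \<theta> v)) has_derivative (\<lambda>h. h \<bullet> (\<Sum>v\<in>I. sgn (x - \<theta> v)))) (at x)"
  unfolding inner_sum_right using assms
  by (intro has_derivative_sum has_derivative_norm_diff) auto

lemma directional_derivative_ge:
  fixes f :: "'a::real_normed_vector \<Rightarrow> real"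
  assumes f': "(f has_derivative f') (at x)" and lip: "\<And>z. f x \<le> f z + norm (z - x)" and e: "norm e = 1"
  shows "-1 \<le> f' e"
proof (rule ccontr)
  \<comment> \<open>\<open>k\<close> is the supposed excess slope. Approximating \<open>f\<close> to
    within \<open>k / 2\<close> along \<open>e\<close> still leaves a drop faster than
    allowed.\<close>
  define k where "k = - 1 - f' e"
  assume "\<not> -1 \<le> f' e"
  then have k: "0 < k" by (simp add: k_def)
  interpret f': bounded_linear f' using f' by (rule has_derivative_bounded_linear)
  from f' half_gt_zero[OF k] obtain d where d: "d > 0"
    "\<And>z. norm (z - x) < d \<Longrightarrow> norm (f z - f x - f' (z - x)) \<le> k / 2 * norm (z - x)"
    unfolding has_derivative_at_alt by blast
  have "norm (f (x + (d / 2) *\<^sub>R e) - f x - d / 2 * f' e) \<le> k / 2 * (d / 2)"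
    using d(2)[of "x + (d / 2) *\<^sub>R e"] d(1) e by (simp add: f'.scaleR)
  moreover have "f x \<le> f (x + (d / 2) *\<^sub>R e) + d / 2"
    using lip[of "x + (d / 2) *\<^sub>R e"] d(1) e by simp
  ultimately have "- (d / 2) - d / 2 * f' e \<le> k / 2 * (d / 2)"
    unfolding real_norm_def by linarith
  moreover have "d / 2 * k = - (d / 2) - d / 2 * f' e"
    by (simp add: k_def right_diff_distrib)
  moreover have "0 < d / 2 * k" using d(1) k by simp
  ultimately show False by (simp add: mult.commute)
qed

text \<open>The deterministic conditions on a good sample. \<open>\<eta>\<close> is a relative
  error, half spent on the Hessian and half on third-order terms; \<open>radius\<close> makes the
  outward slope on the sphere of radius \<open>r\<close> exceed 1 although \<open>\<eta>\<close> and
  \<open>G\<close> reduce it.\<close>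

locale regular_sample =
  fixes V :: nat and \<theta> :: "nat \<Rightarrow> real ^ 'n" and g :: "real ^ 'n" and H :: "real ^ 'n ^ 'n"
    and r \<kappa> \<eta> G :: real
  assumes V_pos: "0 < V" and r_pos: "0 < r"
    and far: "\<And>v. v \<in> {1..V} \<Longrightarrow> 2 * r \<le> norm (g - \<theta> v)"
    and H_symmetric: "\<And>x y. x \<bullet> (H *v y) = (H *v x) \<bullet> y"
    and H_lower: "\<And>x. \<kappa> * (norm x)\<^sup>2 \<le> x \<bullet> (H *v x)"
    and Hessian_error: "norm ((\<Sum>v=1..V. sgn_matrix (g - \<theta> v)) - real V *\<^sub>R H) \<le> \<eta> / 2 * V"
    and third_order: "6 * r * (\<Sum>v=1..V. 1 / (norm (g - \<theta> v))\<^sup>2) \<le> \<eta> / 2 * V"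
    and gradient_bound: "norm (\<Sum>v=1..V. sgn (g - \<theta> v)) \<le> G"
    and radius: "1 + G < V * (\<kappa> / 2) * r"
    and \<eta>_le: "\<eta> \<le> \<kappa> / 2"
begin

text \<open>The gradient of the sum of distances wherever no voter sits, and a subgradient
  everywhere.\<close>

definition \<Psi> :: "real ^ 'n \<Rightarrow> real ^ 'n" where
  "\<Psi> z = (\<Sum>v=1..V. sgn (z - \<theta> v))"

lemma not_voter:
  assumes "norm (z - g) \<le> r" "v \<in> {1..V}"
  shows "z \<noteq> \<theta> v"
proof
  assume "z = \<theta> v"
  with assms far[of v] r_pos show False by (simp add: norm_minus_commute)
qed

text \<open>Two errors of \<open>\<eta> / 2\<close> add up: moving the derivative of each direction
  to \<open>g\<close>, and replacing the empirical Hessian by \<open>V *\<^sub>R H\<close>.\<close>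

lemma \<Psi>_linearization:
  assumes p: "norm (p - g) \<le> r" and q: "norm (q - g) \<le> r"
  shows "norm (\<Psi> q - \<Psi> p - V *\<^sub>R (H *v (q - p))) \<le> \<eta> * V * norm (q - p)"
proof -
  let ?A = "\<Sum>v=1..V. sgn_matrix (g - \<theta> v)"
  have A: "?A *v (q - p) = (\<Sum>v=1..V. sgn_deriv (g - \<theta> v) (q - p))"
    unfolding linear_sum[OF bounded_linear.linear[OF bounded_linear_matrix_vector_mult_left]] sgn_matrix_mult ..
  have "norm (\<Psi> q - \<Psi> p - ?A *v (q - p))
      = norm (\<Sum>v=1..V. sgn (q - \<theta> v) - sgn (p - \<theta> v) - sgn_deriv (g - \<theta> v) (q - p))"
    unfolding A \<Psi>_def by (simp add: sum_subtractf)
  also have "\<dots> \<le> (\<Sum>v=1..V. 6 * r * norm (q - p) / (norm (g - \<theta> v))\<^sup>2)"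
  proof (rule sum_norm_le)
    fix v assume v: "v \<in> {1..V}"
    show "norm (sgn (q - \<theta> v) - sgn (p - \<theta> v) - sgn_deriv (g - \<theta> v) (q - p))
        \<le> 6 * r * norm (q - p) / (norm (g - \<theta> v))\<^sup>2"
      using sgn_linearization_within_ball[OF r_pos far[OF v] p q] by simp
  qed
  also have "\<dots> = 6 * r * (\<Sum>v=1..V. 1 / (norm (g - \<theta> v))\<^sup>2) * norm (q - p)"
    unfolding sum_distrib_left sum_distrib_right by (intro sum.cong) auto
  also have "\<dots> \<le> \<eta> / 2 * V * norm (q - p)"
    by (intro mult_right_mono third_order) simp
  finally have 1: "norm (\<Psi> q - \<Psi> p - ?A *v (q - p)) \<le> \<eta> / 2 * V * norm (q - p)" .
  have "norm ((?A - real V *\<^sub>R H) *v (q - p)) \<le> norm (?A - real V *\<^sub>R H) * norm (q - p)"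
    by (rule norm_matrix_vector_mult_le)
  also have "\<dots> \<le> \<eta> / 2 * V * norm (q - p)"
    by (intro mult_right_mono Hessian_error) simp
  finally have 2: "norm ((?A - real V *\<^sub>R H) *v (q - p)) \<le> \<eta> / 2 * V * norm (q - p)" .
  have "\<Psi> q - \<Psi> p - V *\<^sub>R (H *v (q - p))
      = (\<Psi> q - \<Psi> p - ?A *v (q - p)) + (?A - real V *\<^sub>R H) *v (q - p)"
    by (simp add: matrix_vector_mult_diff_rdistrib scaleR_matrix_vector_assoc)
  then have "norm (\<Psi> q - \<Psi> p - V *\<^sub>R (H *v (q - p)))
      \<le> norm (\<Psi> q - \<Psi> p - ?A *v (q - p)) + norm ((?A - real V *\<^sub>R H) *v (q - p))"
    by (simp only: norm_triangle_ineq)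
  with 1 2 show ?thesis by (simp add: algebra_simps)
qed

text \<open>Summed subgradient inequalities at \<open>z\<close> against the unit slack of a median:
  no median lies beyond \<open>z\<close> in a direction of slope above 1.\<close>

lemma \<Psi>_inner_le:
  assumes "is_Gm V \<theta> s x"
  shows "\<Psi> z \<bullet> (x - z) \<le> norm (x - z)"
proof -
  have "(\<Sum>v=1..V. norm (z - \<theta> v) + sgn (z - \<theta> v) \<bullet> ((x - \<theta> v) - (z - \<theta> v))) \<le> (\<Sum>v=1..V. norm (x - \<theta> v))"
    by (intro sum_mono norm_subgradient)
  then have "(\<Sum>v=1..V. norm (z - \<theta> v)) + \<Psi> z \<bullet> (x - z) \<le> (\<Sum>v=1..V. norm (x - \<theta> v))"
    by (simp add: sum.distrib \<Psi>_def inner_sum_left)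
  with is_Gm_sum_le[OF assms, of z] show ?thesis by (simp add: norm_minus_commute)
qed

text \<open>For a median outside the ball, the linearization applies where the segment from
  \<open>g\<close> meets the sphere. There the outward slope exceeds 1, contradicting
  \<open>\<Psi>_inner_le\<close>.\<close>

lemma is_Gm_near:
  assumes x: "is_Gm V \<theta> s x"
  shows "norm (x - g) \<le> r"
proof (rule ccontr)
  assume "\<not> norm (x - g) \<le> r"
  then have gt: "r < norm (x - g)" by simp
  define e where "e = sgn (x - g)"
  have e: "norm e = 1" using gt r_pos unfolding e_def by (auto simp: norm_sgn)
  have xg: "x - g = norm (x - g) *\<^sub>R e"
  proof -
    have "norm (x - g) \<noteq> 0" using gt r_pos by linarith
    then show ?thesis unfolding e_def sgn_div_norm by simp
  qed
  define z where "z = g + r *\<^sub>R e"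
  have xz: "x - z = (norm (x - g) - r) *\<^sub>R e"
    using xg unfolding z_def by (simp add: algebra_simps)
  have "(norm (x - g) - r) * (\<Psi> z \<bullet> e) \<le> (norm (x - g) - r) * 1"
    using \<Psi>_inner_le[OF x, of z] gt e unfolding xz by simp
  then have up: "\<Psi> z \<bullet> e \<le> 1"
    using gt by (simp add: mult_le_cancel_left)
  have "norm (\<Psi> z - \<Psi> g - V *\<^sub>R (H *v (z - g))) \<le> \<eta> * V * norm (z - g)"
    using r_pos e by (intro \<Psi>_linearization) (auto simp: z_def)
  then have lin: "norm (\<Psi> z - \<Psi> g - V *\<^sub>R (r *\<^sub>R (H *v e))) \<le> \<eta> * V * r"
    using r_pos e by (simp add: z_def matrix_vector_mult_scaleR)
  have "- (\<eta> * V * r) \<le> (\<Psi> z - \<Psi> g - V *\<^sub>R (r *\<^sub>R (H *v e))) \<bullet> e"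
    using lin Cauchy_Schwarz_ineq2[of "\<Psi> z - \<Psi> g - V *\<^sub>R (r *\<^sub>R (H *v e))" e] e by simp
  moreover have "- G \<le> \<Psi> g \<bullet> e"
    using gradient_bound Cauchy_Schwarz_ineq2[of "\<Psi> g" e] e by (simp add: \<Psi>_def)
  moreover have "V * r * \<kappa> \<le> V * r * (e \<bullet> (H *v e))"
    using H_lower[of e] e r_pos by (intro mult_left_mono) auto
  moreover have "\<eta> * V * r \<le> \<kappa> / 2 * V * r"
    using \<eta>_le r_pos by (intro mult_right_mono) auto
  ultimately have "V * (\<kappa> / 2) * r - G \<le> \<Psi> z \<bullet> e"
    by (simp add: inner_diff_left inner_commute algebra_simps)
  with up radius show False by linarith
qed

text \<open>Moving along \<open>- u\<close>, the voters' sum cannot decrease at a rate above 1, the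
  pull of a single report.\<close>

lemma inner_\<Psi>_le_1:
  assumes x: "is_Gm V \<theta> s x" and u: "norm u = 1"
  shows "u \<bullet> \<Psi> x \<le> 1"
proof -
  have "-1 \<le> (- u) \<bullet> \<Psi> x"
    unfolding \<Psi>_def
    using u is_Gm_sum_le[OF x] not_voter[OF is_Gm_near[OF x]]
    by (intro directional_derivative_ge[OF has_derivative_sum_norm_diff]) auto
  then show ?thesis by simp
qed

text \<open>The first-order condition of the truthful loss, differentiable at \<open>x\<close>
  because \<open>x\<close> is neither \<open>t\<close> nor a voter.\<close>

lemma \<Psi>_eq:
  assumes x: "is_Gm V \<theta> t x" and "x \<noteq> t"
  shows "\<Psi> x = sgn (t - x)"
proof -
  let ?F = "\<lambda>z. norm (z - t) + (\<Sum>v=1..V. norm (z - \<theta> v))"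
  have "(?F has_derivative (\<lambda>h. h \<bullet> sgn (x - t) + h \<bullet> \<Psi> x)) (at x)"
    unfolding \<Psi>_def using assms not_voter[OF is_Gm_near[OF x]]
    by (intro has_derivative_add has_derivative_norm_diff has_derivative_sum_norm_diff) auto
  then have "(\<lambda>h. h \<bullet> sgn (x - t) + h \<bullet> \<Psi> x) = (\<lambda>_. 0)"
    using x unfolding is_Gm_iff by (intro differential_zero_maxmin[of x UNIV ?F]) auto
  then have "h \<bullet> (sgn (x - t) + \<Psi> x) = 0" for h
    by (simp add: inner_add_right fun_eq_iff)
  then have "sgn (x - t) + \<Psi> x = 0"
    by (metis inner_eq_zero_iff)
  then have "\<Psi> x = - sgn (x - t)"
    by (simp add: eq_neg_iff_add_eq_0 add.commute)
  then show ?thesis by (simp add: sgn_minus[symmetric])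
qed

text \<open>The reachable medians fill approximately the image of the unit ball under the inverse of
  \<open>V *\<^sub>R H\<close>, whose outer normal at the truthful median \<open>x\<close> is \<open>H *v u\<close>, where \<open>u\<close> is the direction
  from \<open>x\<close> to \<open>t\<close>.  Hence the distance from \<open>t\<close> to any reachable \<open>y\<close> is at least the component
  of \<open>t - x\<close> along that normal, up to an error controlled by \<open>\<eta>\<close>.\<close>

theorem strategyproof:
  assumes x: "is_Gm V \<theta> t x" and y: "is_Gm V \<theta> s y"
    and skew: "\<And>x. norm x * norm (H *v x) \<le> S * (x \<bullet> (H *v x))"
    and "0 < \<kappa>" "0 < \<epsilon>" "0 \<le> S" "0 \<le> \<eta>" and \<eta>: "\<eta> * (1 + S + \<epsilon>) \<le> \<epsilon> * \<kappa>"
  shows "norm (x - t) \<le> (S + \<epsilon>) * norm (y - t)"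
proof (cases "x = t")
  case True
  then show ?thesis using assms by simp
next
  case False
  define u where "u = sgn (t - x)"
  let ?\<rho> = "norm (x - t)" and ?d = "y - x"
  have u: "norm u = 1" using False by (simp add: u_def norm_sgn)
  have tx: "t - x = ?\<rho> *\<^sub>R u"
    using False by (simp add: u_def sgn_div_norm norm_minus_commute)
  have c: "\<kappa> \<le> u \<bullet> (H *v u)" using H_lower[of u] u by simp
  have N: "norm (H *v u) \<le> S * (u \<bullet> (H *v u))" using skew[of u] u by simp
  \<comment> \<open>Here \<open>\<Psi> x = u\<close> has inner product 1 with \<open>u\<close>,
    while that of \<open>\<Psi> y\<close> is at most 1.\<close>
  have "u \<bullet> (\<Psi> y - \<Psi> x) \<le> 0"
    using inner_\<Psi>_le_1[OF y u] u unfolding \<Psi>_eq[OF x False] u_def[symmetric]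
    by (simp add: inner_diff_right power2_norm_eq_inner[symmetric])
  moreover have "u \<bullet> (V *\<^sub>R (H *v ?d) - (\<Psi> y - \<Psi> x)) \<le> \<eta> * V * norm ?d"
  proof -
    have "u \<bullet> (V *\<^sub>R (H *v ?d) - (\<Psi> y - \<Psi> x)) \<le> norm (V *\<^sub>R (H *v ?d) - (\<Psi> y - \<Psi> x))"
      using norm_cauchy_schwarz[of u] u by simp
    also have "\<dots> \<le> \<eta> * V * norm ?d"
      using \<Psi>_linearization[OF is_Gm_near[OF x] is_Gm_near[OF y]] by (simp add: norm_minus_commute)
    finally show ?thesis .
  qed
  ultimately have "V * (u \<bullet> (H *v ?d)) \<le> V * (\<eta> * norm ?d)"
    by (simp add: inner_diff_right algebra_simps)
  then have Hd: "(H *v u) \<bullet> ?d \<le> \<eta> * norm ?d"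
    using V_pos by (simp add: H_symmetric mult_le_cancel_left)
  \<comment> \<open>Splitting \<open>norm ?d\<close> lets each side of the final inequality absorb
    its share of the error.\<close>
  have "norm ?d \<le> norm (y - t) + ?\<rho>"
    using norm_triangle_ineq4[of "y - t" "x - t"] by simp
  then have Hd': "(H *v u) \<bullet> ?d \<le> \<eta> * norm (y - t) + \<eta> * ?\<rho>"
    using Hd mult_left_mono[OF _ \<open>0 \<le> \<eta>\<close>] by (fastforce simp: algebra_simps)
  have "t - y = ?\<rho> *\<^sub>R u - ?d" using tx by (simp add: algebra_simps)
  \<comment> \<open>Only the component of \<open>t - y\<close> along the normal
    \<open>H *v u\<close> matters; comparing its norm with \<open>u \<bullet> (H *v u)\<close>
    brings in the skewness.\<close>
  then have "?\<rho> * (u \<bullet> (H *v u)) - (H *v u) \<bullet> ?d = (H *v u) \<bullet> (t - y)"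
    by (simp only: inner_diff_right inner_scaleR_right inner_commute[of u])
  also have "\<dots> \<le> norm (H *v u) * norm (y - t)"
    using norm_cauchy_schwarz[of "H *v u" "t - y"] by (simp add: norm_minus_commute)
  also have "\<dots> \<le> S * (u \<bullet> (H *v u)) * norm (y - t)"
    using N by (rule mult_right_mono) simp
  finally have main: "(u \<bullet> (H *v u) - \<eta>) * ?\<rho> \<le> (S * (u \<bullet> (H *v u)) + \<eta>) * norm (y - t)"
    using Hd' by (simp add: algebra_simps)
  \<comment> \<open>With \<open>c = u \<bullet> (H *v u)\<close> this says
    \<open>\<eta> * (1 + S + \<epsilon>) \<le> \<epsilon> * c\<close>, which follows from the
    assumption as \<open>\<kappa> \<le> c\<close>.\<close>
  have "S * (u \<bullet> (H *v u)) + \<eta> \<le> (S + \<epsilon>) * (u \<bullet> (H *v u) - \<eta>)"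
  proof -
    have "\<epsilon> * \<kappa> \<le> \<epsilon> * (u \<bullet> (H *v u))"
      using c \<open>0 < \<epsilon>\<close> by (intro mult_left_mono) auto
    moreover have "(S + \<epsilon>) * (u \<bullet> (H *v u) - \<eta>) - (S * (u \<bullet> (H *v u)) + \<eta>)
        = \<epsilon> * (u \<bullet> (H *v u)) - \<eta> * (1 + S + \<epsilon>)"
      by (simp add: algebra_simps)
    ultimately show ?thesis using \<eta> by linarith
  qed
  then have "(S * (u \<bullet> (H *v u)) + \<eta>) * norm (y - t) \<le> (S + \<epsilon>) * (u \<bullet> (H *v u) - \<eta>) * norm (y - t)"
    by (rule mult_right_mono) simp
  with main have "(u \<bullet> (H *v u) - \<eta>) * ?\<rho> \<le> (u \<bullet> (H *v u) - \<eta>) * ((S + \<epsilon>) * norm (y - t))"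
    by (simp add: algebra_simps)
  moreover have "0 < u \<bullet> (H *v u) - \<eta>" using c \<eta>_le \<open>0 < \<kappa>\<close> by linarith
  ultimately show ?thesis by (simp add: mult_le_cancel_left)
qed

end

subsection \<open>Distributions with a locally bounded density\<close>

lemma AE_lborel_hyperplane:
  fixes a :: "'a::euclidean_space"
  assumes "a \<noteq> 0"
  shows "AE x in lborel. a \<bullet> x \<noteq> b"
proof (rule AE_I')
  have "closed {x. a \<bullet> x = b}" by (rule closed_hyperplane)
  moreover have "negligible {x. a \<bullet> x = b}" using assms by (intro negligible_hyperplane) simp
  ultimately show "{x. a \<bullet> x = b} \<in> null_sets lborel"
    by (simp add: negligible_iff_null_sets null_sets_completion_iff)
qed auto

text \<open>Dyadic shells around the pole: the shell at scale \<open>2 ^ (- k)\<close> contributes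
  \<open>O (4 ^ k * 8 ^ (- k))\<close>.\<close>

lemma nn_integral_inverse_square_finite:
  fixes g :: "'a::euclidean_space"
  assumes dim: "3 \<le> DIM('a)" and r: "0 < r"
  shows "(\<integral>\<^sup>+x. ennreal (indicator (cball g r) x * (1 / (norm (g - x))\<^sup>2)) \<partial>lborel) < \<infinity>"
proof -
  let ?B = "\<lambda>k. cball g (r / 2 ^ k)"
  have [measurable]: "?B k \<in> sets borel" for k by simp
  \<comment> \<open>The bound \<open>(2 ^ Suc k / r)\<^sup>2\<close> for the integrand outside the
    ball of radius \<open>r / 2 ^ Suc k\<close>.\<close>
  define a where "a k = 4 * 4 ^ k / r\<^sup>2" for k :: nat
  have a: "0 \<le> a k" for k by (simp add: a_def)
  define c where "c = 4 / r\<^sup>2 * unit_ball_vol (real DIM('a)) * r ^ DIM('a)"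
  have c: "0 \<le> c" using r by (simp add: c_def unit_ball_vol_nonneg)
  have shell: "ennreal (indicator (cball g r) x * (1 / (norm (g - x))\<^sup>2)) \<le> (\<Sum>k. ennreal (a k) * indicator (?B k) x)" for x
  proof (cases "x \<in> cball g r \<and> x \<noteq> g")
    case True
    then have n: "0 < norm (g - x)" "norm (g - x) \<le> r" by (auto simp: dist_norm)
    have lim: "(\<lambda>k. r * (1 / 2) ^ k) \<longlonglongrightarrow> 0"
      by (intro tendsto_mult_right_zero LIMSEQ_realpow_zero) auto
    have "\<forall>\<^sub>F k in sequentially. r * (1 / 2) ^ k < norm (g - x)"
      using n by (intro order_tendstoD(2)[OF lim]) auto
    then have ex: "\<exists>k. r / 2 ^ k < norm (g - x)"
      by (auto simp: eventually_sequentially power_one_over)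
    \<comment> \<open>The first radius below the distance of \<open>x\<close>. It is not index 0,
      since \<open>x\<close> is in the outer ball, so the shell has index
      \<open>m - 1\<close>.\<close>
    define m where "m = (LEAST k. r / 2 ^ k < norm (g - x))"
    have m: "r / 2 ^ m < norm (g - x)" unfolding m_def using ex by (rule LeastI_ex)
    then have "m \<noteq> 0" using n by (cases m) auto
    then obtain k where k: "m = Suc k" using not0_implies_Suc by blast
    have "\<not> r / 2 ^ k < norm (g - x)"
      using not_less_Least[of k "\<lambda>k. r / 2 ^ k < norm (g - x)"] k unfolding m_def by simp
    then have in_k: "x \<in> ?B k" by (simp add: dist_norm)
    have le: "(r / 2 ^ m)\<^sup>2 \<le> (norm (g - x))\<^sup>2"
      using m r by (intro power_mono) auto
    have "1 / (norm (g - x))\<^sup>2 \<le> 1 / (r / 2 ^ m)\<^sup>2"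
      by (intro divide_left_mono[OF le] mult_pos_pos) (use r n in auto)
    also have "\<dots> = a k"
      by (simp add: a_def k power_divide power_mult_distrib power_mult[symmetric] mult.commute[of _ 2] power_mult)
    finally have "ennreal (indicator (cball g r) x * (1 / (norm (g - x))\<^sup>2)) \<le> ennreal (a k) * indicator (?B k) x"
      using True in_k by (simp add: ennreal_leI)
    also have "\<dots> \<le> (\<Sum>k. ennreal (a k) * indicator (?B k) x)"
    proof -
      have "sum f {k} \<le> (\<Sum>k. f k)" for f :: "nat \<Rightarrow> ennreal"
        by (rule sum_le_suminf) auto
      then show ?thesis by simp
    qed
    finally show ?thesis .
  next
    case False
    \<comment> \<open>At the pole itself, division by zero makes the integrand 0.\<close>
    then have zero: "indicator (cball g r) x * (1 / (norm (g - x))\<^sup>2) = 0" by auto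
    show ?thesis unfolding zero by simp
  qed
  have shell_mass: "ennreal (a k) * emeasure lborel (?B k) \<le> ennreal (c * (1 / 2) ^ k)" for k
  proof -
    have "(1 / 2 ^ k) ^ DIM('a) = ((1 / 2 :: real) ^ DIM('a)) ^ k"
      by (simp add: power_one_over power_mult[symmetric] mult.commute)
    also have "\<dots> \<le> ((1 / 2) ^ 3 :: real) ^ k"
      using dim by (intro power_mono power_decreasing) auto
    finally have d: "(1 / 2 ^ k) ^ DIM('a) \<le> (1 / 8 :: real) ^ k" by (simp add: power_one_over)
    have "a k * (unit_ball_vol (real DIM('a)) * (r / 2 ^ k) ^ DIM('a)) = c * 4 ^ k * (1 / 2 ^ k) ^ DIM('a)"
      by (simp add: a_def c_def power_divide)
    also have "\<dots> \<le> c * 4 ^ k * (1 / 8) ^ k"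
      using d c by (intro mult_left_mono) auto
    also have "\<dots> = c * (1 / 2) ^ k"
      by (simp add: power_mult_distrib[symmetric] mult.assoc)
    finally show ?thesis
      using r a by (simp add: emeasure_cball ennreal_mult[symmetric] unit_ball_vol_nonneg ennreal_leI)
  qed
  have "(\<integral>\<^sup>+x. ennreal (indicator (cball g r) x * (1 / (norm (g - x))\<^sup>2)) \<partial>lborel)
      \<le> (\<integral>\<^sup>+x. (\<Sum>k. ennreal (a k) * indicator (?B k) x) \<partial>lborel)"
    by (intro nn_integral_mono shell)
  also have "\<dots> = (\<Sum>k. \<integral>\<^sup>+x. ennreal (a k) * indicator (?B k) x \<partial>lborel)"
    by (rule nn_integral_suminf) measurable
  also have "\<dots> = (\<Sum>k. ennreal (a k) * emeasure lborel (?B k))"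
    by (simp add: nn_integral_cmult_indicator)
  also have "\<dots> \<le> (\<Sum>k. ennreal (c * (1 / 2) ^ k))"
    by (intro suminf_le shell_mass) auto
  also have "\<dots> = ennreal (\<Sum>k. c * (1 / 2) ^ k)"
    using c by (intro suminf_ennreal2) (auto intro!: summable_mult summable_geometric)
  also have "\<dots> < \<infinity>" by simp
  finally show ?thesis .
qed

text \<open>The median lies in the convex set, where the density is continuous and so bounded
  nearby. The inverse square is Lebesgue integrable on a small ball and bounded outside it.\<close>

lemma regular_spatial_distributionI:
  fixes M :: "(real ^ 'n) measure" and p :: "real ^ 'n \<Rightarrow> real"
  assumes dim: "3 \<le> CARD('n)"
    and prob: "prob_space M"
    and S: "convex S" "AE \<theta> in M. \<theta> \<in> S"
    and p[measurable]: "p \<in> borel_measurable borel"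
    and density: "M = density lborel (\<lambda>x. ennreal (p x))"
    and p_cont: "\<And>x. x \<in> S \<Longrightarrow> isCont p x"
    and moment: "integrable M norm"
  shows "regular_spatial_distribution M"
proof -
  interpret prob_space M by fact
  have sets_M [measurable_cong]: "sets M = sets borel" by (simp add: density)
  interpret spatial_distribution M
  proof
    show "AE \<theta> in M. a \<bullet> \<theta> \<noteq> b" if "a \<noteq> 0" for a b
      unfolding density using AE_lborel_hyperplane[OF that, of b] by (subst AE_density) auto
  qed (use sets_M moment dim in auto)
  let ?g = "g_inf M"
  have "isCont p ?g" using g_inf_in_convex[OF S] by (rule p_cont)
  then have "\<forall>\<^sub>F x in nhds ?g. p x < p ?g + 1"
    unfolding continuous_at_imp_continuous_within isCont_def tendsto_at_iff_tendsto_nhds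
    by (intro order_tendstoD) auto
  then obtain r0 where r0: "r0 > 0" "\<And>x. dist x ?g < r0 \<Longrightarrow> p x < p ?g + 1"
    unfolding eventually_nhds_metric by blast
  define r where "r = r0 / 2"
  have r: "r > 0" "\<And>x. x \<in> cball ?g r \<Longrightarrow> p x \<le> p ?g + 1"
    using r0 by (auto simp: r_def dist_commute intro!: less_imp_le)
  have [measurable]: "cball ?g r \<in> sets M" by (simp add: sets_M)
  let ?h = "\<lambda>x. indicator (cball ?g r) x * (1 / (norm (?g - x))\<^sup>2)"
  have "(\<integral>\<^sup>+x. ennreal (1 / (norm (?g - x))\<^sup>2) \<partial>M) \<le> (\<integral>\<^sup>+x. ennreal (1 / r\<^sup>2) + ennreal (?h x) \<partial>M)"
  proof (rule nn_integral_mono)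
    fix x
    show "ennreal (1 / (norm (?g - x))\<^sup>2) \<le> ennreal (1 / r\<^sup>2) + ennreal (?h x)"
    proof (cases "x \<in> cball ?g r")
      case False
      then have "r\<^sup>2 \<le> (norm (?g - x))\<^sup>2" using r by (intro power_mono) (auto simp: dist_norm)
      then have "1 / (norm (?g - x))\<^sup>2 \<le> 1 / r\<^sup>2"
        using r False by (intro divide_left_mono mult_pos_pos) auto
      then show ?thesis using False by (simp add: ennreal_leI)
    qed (simp add: ennreal_plus[symmetric] ennreal_leI del: ennreal_plus)
  qed
  also have "\<dots> = ennreal (1 / r\<^sup>2) + (\<integral>\<^sup>+x. ennreal (?h x) \<partial>M)"
    by (subst nn_integral_add) (auto simp: emeasure_space_1)
  also have "(\<integral>\<^sup>+x. ennreal (?h x) \<partial>M) = (\<integral>\<^sup>+x. ennreal (p x) * ennreal (?h x) \<partial>lborel)"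
    by (subst density, subst nn_integral_density) auto
  also have "\<dots> \<le> (\<integral>\<^sup>+x. ennreal (p ?g + 1) * ennreal (?h x) \<partial>lborel)"
  proof (rule nn_integral_mono)
    fix x
    show "ennreal (p x) * ennreal (?h x) \<le> ennreal (p ?g + 1) * ennreal (?h x)"
      using r(2)[of x] by (cases "x \<in> cball ?g r") (auto intro!: mult_right_mono ennreal_leI)
  qed
  also have "\<dots> = ennreal (p ?g + 1) * (\<integral>\<^sup>+x. ennreal (?h x) \<partial>lborel)"
    by (rule nn_integral_cmult) simp
  also have "ennreal (1 / r\<^sup>2) + \<dots> < \<infinity>"
    using nn_integral_inverse_square_finite[of r ?g] r(1) dim by (simp add: ennreal_mult_less_top)
  finally have "(\<integral>\<^sup>+x. ennreal (1 / (norm (?g - x))\<^sup>2) \<partial>M) < \<infinity>" by (simp add: add_left_mono)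
  then have "integrable M (\<lambda>\<theta>. 1 / (norm (?g - \<theta>))\<^sup>2)"
    by (intro integrableI_bounded) auto
  then show ?thesis by unfold_locales
qed

subsection \<open>High-probability bounds for a random sample\<close>

lemma measure_PiM_component:
  assumes "prob_space M" "i \<in> I" "A \<in> sets M"
  shows "measure (Pi\<^sub>M I (\<lambda>_. M)) {\<omega> \<in> space (Pi\<^sub>M I (\<lambda>_. M)). \<omega> i \<in> A} = measure M A"
proof -
  have "measure M A = measure (distr (Pi\<^sub>M I (\<lambda>_. M)) M (\<lambda>\<omega>. \<omega> i)) A"
    using assms distr_PiM_component[of I "\<lambda>_. M" i] by simp
  also have "\<dots> = measure (Pi\<^sub>M I (\<lambda>_. M)) {\<omega> \<in> space (Pi\<^sub>M I (\<lambda>_. M)). \<omega> i \<in> A}"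
    using assms by (subst measure_distr) (auto intro!: arg_cong[where f = "measure _"])
  finally show ?thesis by simp
qed

context regular_spatial_distribution
begin

abbreviation "g \<equiv> g_inf M"

text \<open>The dominated convergence theorem improves the Markov bound \<open>O (\<rho>\<^sup>2)\<close> for the mass of a ball of
  radius \<open>\<rho>\<close> to \<open>o (\<rho>\<^sup>2)\<close>.\<close>

lemma close_voter_limit:
  "(\<lambda>V. real V * measure M {\<theta> \<in> space M. norm (g - \<theta>) < c / sqrt (real V)}) \<longlonglongrightarrow> 0"
proof -
  let ?A = "\<lambda>V. {\<theta> \<in> space M. norm (g - \<theta>) < c / sqrt (real V)}"
  let ?f = "\<lambda>V \<theta>. indicator (?A V) \<theta> * (1 / (norm (g - \<theta>))\<^sup>2)"
  have int: "integrable M (?f V)" for V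
  proof -
    have "integrable M (\<lambda>\<theta>. 1 / (norm (g - \<theta>))\<^sup>2 * indicator (?A V) \<theta>)"
      by (intro integrable_real_mult_indicator inverse_square) measurable
    then show ?thesis by (simp add: mult.commute)
  qed
  have "(\<lambda>V. \<integral>\<theta>. ?f V \<theta> \<partial>M) \<longlonglongrightarrow> (\<integral>\<theta>. 0 \<partial>M)"
  proof (rule integral_dominated_convergence[OF _ _ inverse_square])
    show "AE \<theta> in M. (\<lambda>V. ?f V \<theta>) \<longlonglongrightarrow> 0"
      using AE_neq[of g]
    proof eventually_elim
      case (elim \<theta>)
      have "(\<lambda>V. c / sqrt (real V)) \<longlonglongrightarrow> 0"
        by (intro real_tendsto_divide_at_top[OF tendsto_const] filterlim_compose[OF sqrt_at_top filterlim_real_sequentially])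
      then have "\<forall>\<^sub>F V in sequentially. c / sqrt (real V) < norm (g - \<theta>)"
        using elim by (intro order_tendstoD(2)[where y = 0]) auto
      then have "\<forall>\<^sub>F V in sequentially. ?f V \<theta> = 0"
        by eventually_elim auto
      then show ?case by (rule tendsto_eventually)
    qed
  qed (auto simp: indicator_def)
  then have "(\<lambda>V. c\<^sup>2 * (\<integral>\<theta>. ?f V \<theta> \<partial>M)) \<longlonglongrightarrow> c\<^sup>2 * 0"
    by (intro tendsto_mult_left) simp
  then have lim: "(\<lambda>V. c\<^sup>2 * (\<integral>\<theta>. ?f V \<theta> \<partial>M)) \<longlonglongrightarrow> 0" by simp
  have "real V * measure M (?A V) \<le> c\<^sup>2 * (\<integral>\<theta>. ?f V \<theta> \<partial>M)" if "0 < V" for V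
  proof -
    have "measure M (?A V) = (\<integral>\<theta>. indicator (?A V) \<theta> \<partial>M)"
      by (simp add: Int_absorb2 subsetI)
    \<comment> \<open>Markov's inequality weighted by the inverse square; the factor
      \<open>1 / V\<close> it yields cancels \<open>real V\<close> in the claim.\<close>
    also have "\<dots> \<le> (\<integral>\<theta>. c\<^sup>2 / V * ?f V \<theta> \<partial>M)"
    proof (rule integral_mono_AE)
      show "integrable M (\<lambda>\<theta>. c\<^sup>2 / V * ?f V \<theta>)" using int by (rule integrable_mult_right)
      show "AE \<theta> in M. indicator (?A V) \<theta> \<le> c\<^sup>2 / V * ?f V \<theta>"
        using AE_neq[of g]
      proof eventually_elim
        case (elim \<theta>)
        show ?case
        proof (cases "\<theta> \<in> ?A V")
          case True
          then have "(norm (g - \<theta>))\<^sup>2 \<le> (c / sqrt (real V))\<^sup>2" by (intro power_mono) auto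
          also have "\<dots> = c\<^sup>2 / V" by (simp add: power_divide)
          finally have "(norm (g - \<theta>))\<^sup>2 * (1 / (norm (g - \<theta>))\<^sup>2) \<le> c\<^sup>2 / V * (1 / (norm (g - \<theta>))\<^sup>2)"
            by (rule mult_right_mono) simp
          then show ?thesis using True elim by simp
        qed simp
      qed
    qed (simp add: less_top[symmetric])
    also have "\<dots> = c\<^sup>2 / V * (\<integral>\<theta>. ?f V \<theta> \<partial>M)" by (rule integral_mult_right_zero)
    finally show ?thesis using that by (simp add: le_divide_eq mult.commute)
  qed
  then have "\<forall>\<^sub>F V in sequentially. real V * measure M (?A V) \<le> c\<^sup>2 * (\<integral>\<theta>. ?f V \<theta> \<partial>M)"
    by (auto simp: eventually_sequentially intro!: exI[of _ 1])
  then show ?thesis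
    by (intro tendsto_sandwich[OF _ _ tendsto_const lim]) auto
qed

text \<open>Four bad events have probability at most \<open>\<delta> / 4\<close> each; outside them
  the sample is regular with radius \<open>K / sqrt (real V)\<close>, and the deterministic bound
  applies.\<close>

theorem asymptotically_strategyproof:
  assumes \<epsilon>: "0 < \<epsilon>" and \<delta>: "0 < \<delta>"
  shows "\<exists>V\<^sub>0\<ge>1. \<forall>V\<ge>V\<^sub>0.
    measure (Pi\<^sub>M {1..V} (\<lambda>_. M))
      {\<theta> \<in> space (Pi\<^sub>M {1..V} (\<lambda>_. M)).
        \<forall>t s x y. is_Gm V \<theta> t x \<longrightarrow> is_Gm V \<theta> s y \<longrightarrow>
          norm (x - t) \<le> (1 + Skew (H_inf M) + \<epsilon>) * norm (y - t)}
      \<ge> 1 - \<delta>"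
proof -

  \<comment> \<open>Choice of the constants\<close>
  let ?H = "H_inf M"
  obtain \<kappa> where \<kappa>: "\<kappa> > 0" "\<And>x. x \<bullet> (?H *v x) \<ge> \<kappa> * (norm x)\<^sup>2"
    using pos_def_matrix_lower_bound[of ?H] H_inf_pos by blast
  define S where "S = 1 + Skew ?H"
  have S: "1 \<le> S" using Skew_nonneg[of ?H] H_inf_pos by (simp add: S_def)
  \<comment> \<open>The first bound preserves half of \<open>\<kappa>\<close>; the second is the
    smallness that \<open>strategyproof\<close> demands.\<close>
  define \<eta> where "\<eta> = min (\<kappa> / 2) (\<epsilon> * \<kappa> / (1 + S + \<epsilon>))"
  have \<eta>: "0 < \<eta>" "\<eta> \<le> \<kappa> / 2" "\<eta> * (1 + S + \<epsilon>) \<le> \<epsilon> * \<kappa>"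
  proof -
    show "0 < \<eta>" using \<kappa> \<epsilon> S by (simp add: \<eta>_def)
    show "\<eta> \<le> \<kappa> / 2" unfolding \<eta>_def by (rule min.cobounded1)
    have "\<eta> \<le> \<epsilon> * \<kappa> / (1 + S + \<epsilon>)" by (simp add: \<eta>_def)
    then show "\<eta> * (1 + S + \<epsilon>) \<le> \<epsilon> * \<kappa>" using S \<epsilon> by (simp add: le_divide_eq)
  qed
  \<comment> \<open>Chosen so that \<open>\<kappa> / 2 * K = 2 + 2 / sqrt \<delta>\<close>: the last
    term pays for the gradient bound \<open>sqrt (4 * V / \<delta>)\<close>, the 2 for the unit pull
    of a report.\<close>
  define K where "K = 2 * (2 + 2 / sqrt \<delta>) / \<kappa>"
  have K: "0 < K" using \<kappa> \<delta> by (auto simp: K_def intro!: divide_pos_pos add_pos_nonneg)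
  define I2 where "I2 = (\<integral>\<theta>. 1 / (norm (g - \<theta>))\<^sup>2 \<partial>M)"
  have I2: "0 \<le> I2" by (simp add: I2_def)
  \<comment> \<open>A Markov threshold per voter that gives probability at most
    \<open>\<delta> / 4\<close>; adding 1 keeps it positive.\<close>
  define c2 where "c2 = 4 * (I2 + 1) / \<delta>"
  have c2: "0 < c2" using I2 \<delta> by (simp add: c2_def)
  define I3 where "I3 = (\<integral>\<theta>. (norm (sgn_matrix (g - \<theta>) - ?H))\<^sup>2 \<partial>M)"
  \<comment> \<open>Despite its name, the set of positions too close to the median, which violate
    the locale condition \<open>far\<close>.\<close>
  define far where "far V = {\<theta> \<in> space M. norm (g - \<theta>) < 2 * K / sqrt (real V)}" for V :: nat
  have far[measurable]: "far V \<in> sets M" for V unfolding far_def by measurable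
  have lim_r: "(\<lambda>V. K / sqrt (real V)) \<longlonglongrightarrow> 0"
    by (intro real_tendsto_divide_at_top[OF tendsto_const] filterlim_compose[OF sqrt_at_top filterlim_real_sequentially])
  have lim_H: "(\<lambda>V. 4 * I3 / \<eta>\<^sup>2 / real V) \<longlonglongrightarrow> 0"
    by (intro real_tendsto_divide_at_top[OF tendsto_const] filterlim_real_sequentially)
  have "\<forall>\<^sub>F V in sequentially. real V * measure M (far V) < \<delta> / 4"
    using close_voter_limit[of "2 * K"] \<delta> unfolding far_def by (intro order_tendstoD(2)[where y = 0]) auto
  \<comment> \<open>Together with the threshold \<open>c2 * V\<close> this yields
    \<open>6 * r * (c2 * V) \<le> \<eta> / 2 * V\<close>.\<close>
  moreover have "\<forall>\<^sub>F V in sequentially. K / sqrt (real V) < \<eta> / (12 * c2)"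
    using lim_r \<eta> c2 by (intro order_tendstoD(2)[where y = 0]) auto
  moreover have "\<forall>\<^sub>F V in sequentially. 4 * I3 / \<eta>\<^sup>2 / real V < \<delta> / 4"
    using lim_H \<delta> by (intro order_tendstoD(2)[where y = 0]) auto
  ultimately have "\<forall>\<^sub>F V in sequentially. 1 \<le> V \<and> real V * measure M (far V) < \<delta> / 4
      \<and> K / sqrt (real V) < \<eta> / (12 * c2) \<and> 4 * I3 / \<eta>\<^sup>2 / real V < \<delta> / 4"
    using eventually_ge_at_top[of 1] by eventually_elim auto
  then obtain V\<^sub>0 where V\<^sub>0: "\<And>V. V \<ge> V\<^sub>0 \<Longrightarrow> 1 \<le> V \<and> real V * measure M (far V) < \<delta> / 4
      \<and> K / sqrt (real V) < \<eta> / (12 * c2) \<and> 4 * I3 / \<eta>\<^sup>2 / real V < \<delta> / 4"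
    unfolding eventually_sequentially by blast
  have main: "1 - \<delta> \<le> measure (Pi\<^sub>M {1..V} (\<lambda>_. M)) {\<theta> \<in> space (Pi\<^sub>M {1..V} (\<lambda>_. M)).
      \<forall>t s x y. is_Gm V \<theta> t x \<longrightarrow> is_Gm V \<theta> s y \<longrightarrow> norm (x - t) \<le> (1 + Skew ?H + \<epsilon>) * norm (y - t)}"
    (is "_ \<le> measure ?P ?good") if "V \<ge> V\<^sub>0" for V
  proof -
    have V: "0 < V" and far_small: "real V * measure M (far V) \<le> \<delta> / 4"
      and r_small: "K / sqrt (real V) < \<eta> / (12 * c2)" and H_small: "4 * I3 / \<eta>\<^sup>2 / real V \<le> \<delta> / 4"
      using V\<^sub>0[OF that] by auto
    define r where "r = K / sqrt (real V)"
    have r: "0 < r" using K V by (simp add: r_def)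
    interpret P: prob_space ?P by (intro prob_space_PiM prob_space_axioms)
    have comp[measurable]: "(\<lambda>\<theta>. \<theta> v) \<in> measurable ?P M" if "v \<in> {1..V}" for v
      using that by (rule measurable_component_singleton)
    let ?S2 = "\<lambda>\<theta>. \<Sum>v=1..V. 1 / (norm (g - \<theta> v))\<^sup>2"
    let ?S3 = "\<lambda>\<theta>. \<Sum>v=1..V. sgn_matrix (g - \<theta> v) - ?H"
    let ?S4 = "\<lambda>\<theta>. \<Sum>v=1..V. sgn (g - \<theta> v)"
    \<comment> \<open>The events cover, in order, the failures of \<open>far\<close>,
      \<open>third_order\<close>, \<open>Hessian_error\<close> and
      \<open>gradient_bound\<close>.\<close>
    define B1 where "B1 = (\<Union>v\<in>{1..V}. {\<theta> \<in> space ?P. \<theta> v \<in> far V})"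
    define B2 where "B2 = {\<theta> \<in> space ?P. c2 * V \<le> ?S2 \<theta>}"
    define B3 where "B3 = {\<theta> \<in> space ?P. (\<eta> / 2 * V)\<^sup>2 \<le> (norm (?S3 \<theta>))\<^sup>2}"
    define B4 where "B4 = {\<theta> \<in> space ?P. 4 * V / \<delta> \<le> (norm (?S4 \<theta>))\<^sup>2}"
    have sets[measurable]: "B1 \<in> sets ?P" "B2 \<in> sets ?P" "B3 \<in> sets ?P" "B4 \<in> sets ?P"
      unfolding B1_def B2_def B3_def B4_def by measurable

    \<comment> \<open>Probabilities of the bad events\<close>
    have B1: "measure ?P B1 \<le> \<delta> / 4"
    proof -
      have "measure ?P B1 \<le> (\<Sum>v=1..V. measure ?P {\<theta> \<in> space ?P. \<theta> v \<in> far V})"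
        unfolding B1_def by (intro P.finite_measure_subadditive_finite) auto
      also have "\<dots> = (\<Sum>v=1..V. measure M (far V))"
        by (intro sum.cong refl measure_PiM_component prob_space_axioms far)
      finally show ?thesis using far_small by simp
    qed
    have B2: "measure ?P B2 \<le> \<delta> / 4"
    proof -
      have int: "integrable ?P (\<lambda>\<theta>. 1 / (norm (g - \<theta> v))\<^sup>2)" if "v \<in> {1..V}" for v
        using integrable_PiM_component[OF prob_space_axioms that, of "\<lambda>\<theta>. 1 / (norm (g - \<theta>))\<^sup>2"] inverse_square by simp
      have "(\<integral>\<theta>. ?S2 \<theta> \<partial>?P) = (\<Sum>v=1..V. \<integral>\<theta>. 1 / (norm (g - \<theta> v))\<^sup>2 \<partial>?P)"
        using int by (rule Bochner_Integration.integral_sum)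
      also have "\<dots> = (\<Sum>v=1..V. I2)"
        unfolding I2_def by (intro sum.cong refl integral_PiM_component[OF prob_space_axioms]) auto
      finally have E: "(\<integral>\<theta>. ?S2 \<theta> \<partial>?P) = V * I2" by simp
      have "measure ?P B2 \<le> (\<integral>\<theta>. ?S2 \<theta> \<partial>?P) / (c2 * V)"
        unfolding B2_def using c2 V int
        by (intro integral_Markov_inequality_measure[where A = "space ?P"]) (auto intro!: sum_nonneg)
      also have "\<dots> = \<delta> / 4 * (I2 / (I2 + 1))"
      proof -
        have "real V * I2 / (4 * q / \<delta> * real V) = \<delta> / 4 * (I2 / q)" if "0 < q" for q
          using that V \<delta> by (simp add: field_simps)
        from this[of "I2 + 1"] show ?thesis unfolding E c2_def using I2 by linarith
      qed
      also have "\<dots> \<le> \<delta> / 4 * 1"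
        using I2 \<delta> by (intro mult_left_mono) auto
      finally show ?thesis by simp
    qed
    have B3: "measure ?P B3 \<le> \<delta> / 4"
    proof -
      have sq: "integrable M (\<lambda>\<theta>. (norm (sgn_matrix (g - \<theta>) - ?H))\<^sup>2)"
      proof (rule Bochner_Integration.integrable_bound)
        show "integrable M (\<lambda>\<theta>. 2 * (norm (sgn_matrix (g - \<theta>)))\<^sup>2 + 2 * (norm ?H)\<^sup>2)"
          by (intro Bochner_Integration.integrable_add integrable_mult_right integrable_sgn_matrix_square) simp
        show "AE \<theta> in M. norm ((norm (sgn_matrix (g - \<theta>) - ?H))\<^sup>2)
            \<le> norm (2 * (norm (sgn_matrix (g - \<theta>)))\<^sup>2 + 2 * (norm ?H)\<^sup>2)"
        proof (rule AE_I2)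
          fix \<theta>
          have "(norm (sgn_matrix (g - \<theta>) - ?H))\<^sup>2 \<le> (norm (sgn_matrix (g - \<theta>)) + norm ?H)\<^sup>2"
            by (intro power_mono norm_triangle_ineq4) simp
          also have "\<dots> \<le> 2 * (norm (sgn_matrix (g - \<theta>)))\<^sup>2 + 2 * (norm ?H)\<^sup>2"
            using sum_squares_bound[of "norm (sgn_matrix (g - \<theta>))" "norm ?H"] by (simp add: power2_sum)
          finally show "norm ((norm (sgn_matrix (g - \<theta>) - ?H))\<^sup>2)
            \<le> norm (2 * (norm (sgn_matrix (g - \<theta>)))\<^sup>2 + 2 * (norm ?H)\<^sup>2)" by simp
        qed
      qed simp
      have mean: "(\<integral>\<theta>. sgn_matrix (g - \<theta>) - ?H \<partial>M) = 0"
        using integrable_sgn_matrix by (simp add: H_inf_eq prob_space)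
      \<comment> \<open>Chebyshev: the squared norm of the centred sum has mean
        \<open>V * I3\<close>, against a threshold quadratic in \<open>V\<close>.\<close>
      have "measure ?P B3 \<le> (\<integral>\<theta>. (norm (?S3 \<theta>))\<^sup>2 \<partial>?P) / (\<eta> / 2 * V)\<^sup>2"
        unfolding B3_def using \<eta> V
        by (intro integral_Markov_inequality_measure[where A = "space ?P"]
            integrable_norm_sum_square_PiM[OF prob_space_axioms _ _ sq mean]) auto
      also have "\<dots> = 4 * I3 / \<eta>\<^sup>2 / V"
        using V \<eta> integral_norm_sum_square_PiM[OF prob_space_axioms _ _ sq mean, of "{1..V}"]
        by (simp add: I3_def power2_eq_square field_simps)
      also have "\<dots> \<le> \<delta> / 4" by (rule H_small)
      finally show ?thesis .
    qed
    have B4: "measure ?P B4 \<le> \<delta> / 4"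
    proof -
      have sq: "integrable M (\<lambda>\<theta>. (norm (sgn (g - \<theta>)))\<^sup>2)"
        by (rule integrable_const_bound[of _ 1]) (auto simp: norm_sgn)
      have "measure ?P B4 \<le> (\<integral>\<theta>. (norm (?S4 \<theta>))\<^sup>2 \<partial>?P) / (4 * V / \<delta>)"
        unfolding B4_def using \<delta> V
        by (intro integral_Markov_inequality_measure[where A = "space ?P"]
            integrable_norm_sum_square_PiM[OF prob_space_axioms _ _ sq mean_direction_g_inf]) auto
      \<comment> \<open>The second moment grows like \<open>V\<close>, which cancels the
        \<open>V\<close> of the threshold; directions have norm at most 1.\<close>
      also have "\<dots> = \<delta> / 4 * (\<integral>\<theta>. (norm (sgn (g - \<theta>)))\<^sup>2 \<partial>M)"
        using V \<delta> integral_norm_sum_square_PiM[OF prob_space_axioms _ _ sq mean_direction_g_inf, of "{1..V}"]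
        by (simp add: field_simps)
      also have "\<dots> \<le> \<delta> / 4 * 1"
      proof (rule mult_left_mono)
        have "(\<integral>\<theta>. (norm (sgn (g - \<theta>)))\<^sup>2 \<partial>M) \<le> (\<integral>\<theta>. 1 \<partial>M)"
          using sq by (intro integral_mono) (auto simp: norm_sgn)
        then show "(\<integral>\<theta>. (norm (sgn (g - \<theta>)))\<^sup>2 \<partial>M) \<le> 1" by (simp add: prob_space)
      qed (use \<delta> in simp)
      finally show ?thesis by simp
    qed

    \<comment> \<open>Regularity of the sample outside the bad events\<close>
    have good: "?good \<in> sets ?P" by (rule sets_strategyproof_event[OF sets_M])
    have "space ?P - (B1 \<union> B2 \<union> B3 \<union> B4) \<subseteq> ?good"
    proof
      fix \<theta> assume \<theta>: "\<theta> \<in> space ?P - (B1 \<union> B2 \<union> B3 \<union> B4)"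
      have not_far: "\<theta> v \<notin> far V" if "v \<in> {1..V}" for v using \<theta> that by (auto simp: B1_def)
      have b2: "?S2 \<theta> \<le> c2 * V" using \<theta> by (auto simp: B2_def)
      have "(norm (?S3 \<theta>))\<^sup>2 \<le> (\<eta> / 2 * V)\<^sup>2" using \<theta> by (auto simp: B3_def)
      then have b3: "norm (?S3 \<theta>) \<le> \<eta> / 2 * V" by (rule power2_le_imp_le) (use \<eta> in simp)
      have "(norm (?S4 \<theta>))\<^sup>2 \<le> 4 * V / \<delta>" using \<theta> by (auto simp: B4_def)
      then have b4: "norm (?S4 \<theta>) \<le> sqrt (4 * V / \<delta>)" by (rule real_le_rsqrt)
      interpret regular_sample V \<theta> g ?H r \<kappa> \<eta> "sqrt (4 * V / \<delta>)"
      proof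
        show "2 * r \<le> norm (g - \<theta> v)" if "v \<in> {1..V}" for v
        proof -
          have "\<theta> v \<in> space M" using \<theta> that by (auto simp: space_PiM PiE_iff)
          then show ?thesis using not_far[OF that] by (simp add: far_def r_def not_less)
        qed
        show "norm ((\<Sum>v=1..V. sgn_matrix (g - \<theta> v)) - real V *\<^sub>R ?H) \<le> \<eta> / 2 * V"
          using b3 unfolding sum_subtractf sum_constant_scaleR by simp
        have "6 * r * ?S2 \<theta> \<le> 6 * (\<eta> / (12 * c2)) * (c2 * V)"
          using r_small r b2 \<eta> c2 unfolding r_def[symmetric]
          by (intro mult_mono) (auto intro!: sum_nonneg)
        also have "\<dots> = \<eta> / 2 * V" using c2 by simp
        finally show "6 * r * ?S2 \<theta> \<le> \<eta> / 2 * V" .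
        have sV: "1 \<le> sqrt (real V)" using V by simp
        have "1 + sqrt (4 * V / \<delta>) = 1 + sqrt (real V) * (2 / sqrt \<delta>)"
          by (simp add: real_sqrt_divide real_sqrt_mult)
        also have "\<dots> < sqrt (real V) * 2 + sqrt (real V) * (2 / sqrt \<delta>)"
          using sV by linarith
        also have "\<dots> = sqrt (real V) * (\<kappa> / 2 * K)"
        proof -
          have "\<kappa> / 2 * K = 2 + 2 / sqrt \<delta>" using \<kappa>(1) by (simp add: K_def)
          then show ?thesis by (simp only: distrib_left)
        qed
        also have "\<dots> = V * (\<kappa> / 2) * r"
          using V by (simp add: r_def field_simps)
        finally show "1 + sqrt (4 * V / \<delta>) < V * (\<kappa> / 2) * r" .
      qed (use V r \<kappa> b4 \<eta> H_inf_symmetric in auto)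
      have "norm (x - t) \<le> (S + \<epsilon>) * norm (y - t)" if "is_Gm V \<theta> t x" "is_Gm V \<theta> s y" for t s x y
        using that
      proof (rule strategyproof)
        show "norm x * norm (?H *v x) \<le> S * (x \<bullet> (?H *v x))" for x
          unfolding S_def using H_inf_pos by (rule Skew_upper)
      qed (use \<kappa> \<epsilon> S \<eta> in auto)
      then show "\<theta> \<in> ?good" using \<theta> unfolding S_def by blast
    qed
    \<comment> \<open>Monotonicity of the measure requires \<open>?good\<close> to be
      measurable.\<close>
    then have "measure ?P (space ?P - (B1 \<union> B2 \<union> B3 \<union> B4)) \<le> measure ?P ?good"
      using good by (rule P.finite_measure_mono)
    moreover have "measure ?P (space ?P - (B1 \<union> B2 \<union> B3 \<union> B4)) = 1 - measure ?P (B1 \<union> B2 \<union> B3 \<union> B4)"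
      by (rule P.prob_compl) measurable
    moreover have "measure ?P (B1 \<union> B2 \<union> B3 \<union> B4) \<le> measure ?P B1 + measure ?P B2 + measure ?P B3 + measure ?P B4"
      using measure_Un_le[of B1 ?P B2] measure_Un_le[of "B1 \<union> B2" ?P B3] measure_Un_le[of "B1 \<union> B2 \<union> B3" ?P B4] sets
      by auto
    ultimately show ?thesis using B1 B2 B3 B4 by linarith
  qed
  have "1 \<le> V\<^sub>0" using V\<^sub>0[of V\<^sub>0] by simp
  with main show ?thesis by blast
qed

end

theorem theorem2:
  fixes M :: "(real ^ 'n) measure"
    and p :: "real ^ 'n \<Rightarrow> real"
    and \<Theta> :: "(real ^ 'n) set"
    and \<epsilon> \<delta> :: real
  assumes dim: "CARD('n) \<ge> 5"
    and prob: "prob_space M"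
    and convex_Theta: "convex \<Theta>"
    and open_Theta: "open \<Theta>"
    and p_measurable: "p \<in> borel_measurable borel"
    and p_nonneg: "\<And>x. 0 \<le> p x"
    and density: "M = density lborel (\<lambda>x. ennreal (p x))"
    and p_C1: "cont_differentiable_on p \<Theta>"
    and support: "measure M \<Theta> = 1"
    and moment: "integrable M (\<lambda>\<theta>. norm \<theta>)"
    and eps: "\<epsilon> > 0"
    and delta: "\<delta> > 0"
  shows "\<exists>V\<^sub>0\<ge>1. \<forall>V\<ge>V\<^sub>0.
    measure (Pi\<^sub>M {1..V} (\<lambda>_. M))
      {\<theta> \<in> space (Pi\<^sub>M {1..V} (\<lambda>_. M)).
        \<forall>t s g\<^sub>t g\<^sub>s. is_Gm V \<theta> t g\<^sub>t \<longrightarrow> is_Gm V \<theta> s g\<^sub>s \<longrightarrow>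
          norm (g\<^sub>t - t) \<le> (1 + Skew (H_inf M) + \<epsilon>) * norm (g\<^sub>s - t)}
      \<ge> 1 - \<delta>"
proof -
  \<comment> \<open>Differentiability of \<open>p\<close> gives continuity on
    \<open>\<Theta>\<close>, and full mass gives almost sure membership.\<close>
  have "regular_spatial_distribution M"
  proof (rule regular_spatial_distributionI)
    show "AE \<theta> in M. \<theta> \<in> \<Theta>"
      using prob support by (rule prob_space.AE_prob_1)
    show "isCont p x" if "x \<in> \<Theta>" for x
      using p_C1 that unfolding cont_differentiable_on_def gderiv_def
      by (blast intro: has_derivative_continuous)
  qed (use assms in auto)
  then show ?thesis
    using eps delta by (rule regular_spatial_distribution.asymptotically_strategyproof)
qed

end
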